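(* Every $n$-vertex graph containing no induced copy of $P_5$ contains an induced subgraph which is a cograph on at least $2^{(\log n)^{2/3}/16}$ vertices.
   Context: $P_5$ denotes the path on five vertices. Logarithms are in base $2$. A cograph is defined recursively: a single-vertex graph is a cograph, and a graph obtained as a vertex-disjoint union of two smaller cographs whose vertex sets form a pure pair (either all edges between them are present or none are) is a cograph. *)

theory Defs
  imports Complex_Main "Graph_Theory.Graph_Theory"
begin

text \<open>
  Finite simple graphs are represented by the locale \<^locale>\<open>graph\<close>: finite symmetric digraphs
  without loops and without parallel arcs. Each edge appears as two opposite arcs.
\<close>

definition path_graph :: "nat \<Rightarrow> nat pair_pre_digraph" where
  "path_graph k = \<lparr> pverts = {..<k}, parcs = {(i, j). i < k \<and> j < k \<and> (j = Suc i \<or> i = Suc j)} \<rparr>"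

definition contains_induced_copy ::
    "('a, 'b) pre_digraph \<Rightarrow> ('c, 'd) pre_digraph \<Rightarrow> bool" where
  "contains_induced_copy G P \<longleftrightarrow> (\<exists>H. induced_subgraph H G \<and> digraph_iso H P)"

definition pure_pair :: "('a, 'b) pre_digraph \<Rightarrow> 'a set \<Rightarrow> 'a set \<Rightarrow> bool" where
  "pure_pair G A B \<longleftrightarrow> A \<inter> B = {} \<and>
     ((\<forall>a\<in>A. \<forall>b\<in>B. a \<rightarrow>\<^bsub>G\<^esub> b) \<or> (\<forall>a\<in>A. \<forall>b\<in>B. \<not> a \<rightarrow>\<^bsub>G\<^esub> b))"

text \<open>
  The two parts in the second rule are automatically smaller than \<open>G\<close>: every cograph has a
  vertex, and the parts are disjoint.
\<close>
inductive cograph :: "('a, 'b) pre_digraph \<Rightarrow> bool" where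
  single_vertex: "\<lbrakk> graph G; verts G = {v} \<rbrakk> \<Longrightarrow> cograph G"
| disjoint_union: "\<lbrakk> graph G; verts G = A \<union> B; pure_pair G A B;
      cograph (G \<restriction> A); cograph (G \<restriction> B) \<rbrakk> \<Longrightarrow> cograph G"

end

theory Submission
  imports Defs
begin

text \<open>
  Let \<open>T\<close> be the target size, \<open>t = log T\<close>, and suppose the bound for smaller graphs. It suffices to find
  \<open>2 ^ k\<close> vertex sets, with \<open>k\<close> of order \<open>sqrt t\<close>, that are pairwise pure in a cograph pattern and of
  size \<open>n\<close> divided by \<open>2\<close> to a power of order \<open>t\<close>. A theorem of Fox and Sudakov provides a set of that
  size in which the graph or its complement has density at most \<open>2\<close> to the power \<open>- C * k\<close>.

  In a sparse \<open>P\<^sub>5\<close>-free graph, Gyarfas' path argument splits every set into two linear-sized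
  anticomplete parts, and iterating this gives the \<open>2 ^ k\<close> sets.

  In a dense graph without a clique of size \<open>T\<close>, some vertex \<open>v\<close> has a set \<open>A\<close> of at least about
  \<open>1 / T\<close> of all vertices as non-neighbours, and \<open>A\<close> may again be taken dense. For a neighbour \<open>b\<close> of \<open>v\<close>,
  every component of the non-neighbourhood of \<open>b\<close> in \<open>A\<close> is a homogeneous set in \<open>A\<close>, so that it is
  complete to almost all of \<open>A\<close>. Either this occurs \<open>2 ^ k\<close> times within \<open>A\<close>, or nearly all vertices
  have so few non-neighbours in a large part of \<open>A\<close> that a cograph inside this part is complete to
  almost all the rest; then one continues with the rest, up to \<open>2 ^ k\<close> times.

  The gain of a factor \<open>2 ^ k\<close> pays for the loss in size once \<open>(log n) powr (1/3)\<close> is at least \<open>64\<close>;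
  for smaller \<open>n\<close> the classical Erdos-Hajnal doubling is enough.
\<close>

section \<open>Cographs, path-freeness and degrees for one ambient relation\<close>

inductive cog :: "('a \<Rightarrow> 'a \<Rightarrow> bool) \<Rightarrow> 'a set \<Rightarrow> bool" for E where
  cog_empty: "cog E {}"
| cog_single: "cog E {v}"
| cog_union: "cog E A \<Longrightarrow> cog E B \<Longrightarrow> A \<inter> B = {} \<Longrightarrow>
    (\<forall>a\<in>A. \<forall>b\<in>B. E a b) \<or> (\<forall>a\<in>A. \<forall>b\<in>B. \<not> E a b) \<Longrightarrow> cog E (A \<union> B)"

text \<open>For symmetric \<open>E\<close> the five vertices are distinct, since their adjacencies differ.\<close>

definition p5_free :: "('a \<Rightarrow> 'a \<Rightarrow> bool) \<Rightarrow> 'a set \<Rightarrow> bool" where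
  "p5_free E V \<longleftrightarrow> \<not> (\<exists>a\<in>V. \<exists>b\<in>V. \<exists>c\<in>V. \<exists>d\<in>V. \<exists>e\<in>V. E a b \<and> E b c \<and> E c d \<and> E d e \<and>
     \<not> E a c \<and> \<not> E a d \<and> \<not> E a e \<and> \<not> E b d \<and> \<not> E b e \<and> \<not> E c e)"

definition compl_rel :: "('a \<Rightarrow> 'a \<Rightarrow> bool) \<Rightarrow> 'a \<Rightarrow> 'a \<Rightarrow> bool" where
  "compl_rel E x y \<longleftrightarrow> x \<noteq> y \<and> \<not> E x y"

definition deg :: "('a \<Rightarrow> 'a \<Rightarrow> bool) \<Rightarrow> 'a set \<Rightarrow> 'a \<Rightarrow> nat" where
  "deg R S v = card {u \<in> S. R v u}"

text \<open>The induction hypothesis in the form in which the combination arguments use it: one size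
  threshold and one guaranteed cograph size.\<close>

definition rich :: "('a \<Rightarrow> 'a \<Rightarrow> bool) \<Rightarrow> 'a set \<Rightarrow> real \<Rightarrow> real \<Rightarrow> bool" where
  "rich E V M q \<longleftrightarrow> (\<forall>S\<subseteq>V. M \<le> real (card S) \<longrightarrow> (\<exists>Q\<subseteq>S. cog E Q \<and> q \<le> real (card Q)))"

lemma p5_free_subset: "p5_free E V \<Longrightarrow> U \<subseteq> V \<Longrightarrow> p5_free E U"
  unfolding p5_free_def by (meson subsetD)

lemma richE:
  assumes "rich E V M q" "S \<subseteq> V" "M \<le> real (card S)"
  obtains Q where "Q \<subseteq> S" "cog E Q" "q \<le> real (card Q)"
  using assms unfolding rich_def by blast

lemma deg_mono: "finite S \<Longrightarrow> S' \<subseteq> S \<Longrightarrow> deg R S' v \<le> deg R S v"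
  unfolding deg_def by (rule card_mono) auto

lemma deg_Un_disjoint:
  assumes "finite A" "finite B" "A \<inter> B = {}"
  shows "deg R (A \<union> B) v = deg R A v + deg R B v"
proof -
  have "{u \<in> A \<union> B. R v u} = {u \<in> A. R v u} \<union> {u \<in> B. R v u}" by auto
  then show ?thesis unfolding deg_def using assms by (auto intro!: card_Un_disjoint)
qed

lemma deg_le_card: "finite S \<Longrightarrow> deg R S v \<le> card S"
  unfolding deg_def by (rule card_mono) auto

section \<open>Double counting and averaging\<close>

lemma sum_deg_swap:
  assumes "symp R" "finite X" "finite Y"
  shows "(\<Sum>x\<in>X. deg R Y x) = (\<Sum>y\<in>Y. deg R X y)"
proof -
  have sym: "R x y = R y x" for x y using assms(1) by (meson sympD)
  have c: "card {u\<in>S. R v u} = (\<Sum>u\<in>S. if R v u then 1 else 0)" if "finite S" for S v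
    using that by (simp add: sum.If_cases Int_def)
  show ?thesis unfolding deg_def
    by (simp only: c assms) (subst sum.swap, simp add: sym)
qed

lemma markov_card:
  fixes f :: "'a \<Rightarrow> real"
  assumes "finite X" "\<And>x. x \<in> X \<Longrightarrow> 0 \<le> f x"
  shows "l * real (card {x\<in>X. l < f x}) \<le> sum f X"
proof -
  have "l * real (card {x\<in>X. l < f x}) = (\<Sum>x\<in>{x\<in>X. l < f x}. l)" by simp
  also have "\<dots> \<le> (\<Sum>x\<in>{x\<in>X. l < f x}. f x)" by (rule sum_mono) auto
  also have "\<dots> \<le> sum f X" using assms by (intro sum_mono2) auto
  finally show ?thesis .
qed

lemma markov_half:
  fixes f :: "'a \<Rightarrow> real"
  assumes "finite X" "\<And>x. x \<in> X \<Longrightarrow> 0 \<le> f x" "sum f X \<le> c * real (card X)" "0 \<le> c"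
  shows "real (card X) / 2 \<le> real (card {x\<in>X. f x \<le> 2 * c})"
proof -
  let ?B = "{x\<in>X. 2 * c < f x}" and ?G = "{x\<in>X. f x \<le> 2 * c}"
  have XX: "X = ?B \<union> ?G" by auto
  have "card (?B \<union> ?G) = card ?B + card ?G" by (rule card_Un_disjoint) (use assms in auto)
  then have eq: "card X = card ?B + card ?G" using XX by simp
  show ?thesis
  proof (cases "c = 0")
    \<comment> \<open>Markov's inequality says nothing about the exceptional set if \<open>c\<close>
      is zero, but then all values vanish.\<close>
    case True
    then have "sum f X = 0" using assms sum_nonneg[of X f] by auto
    then have "\<forall>x\<in>X. f x = 0" using assms by (subst (asm) sum_nonneg_eq_0_iff) auto
    then have "?G = X" using True by auto
    then show ?thesis by simp
  next
    case False
    have "2 * c * real (card ?B) \<le> sum f X" by (rule markov_card) (use assms in auto)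
    then have "c * (2 * real (card ?B)) \<le> c * real (card X)" using assms by simp
    then have "2 * real (card ?B) \<le> real (card X)" using False assms by simp
    then show ?thesis using eq by linarith
  qed
qed

lemma sum_deg_le:
  assumes "\<And>x. x \<in> X \<Longrightarrow> real (deg R Y x) \<le> c"
  shows "(\<Sum>x\<in>X. real (deg R Y x)) \<le> real (card X) * c"
  using sum_mono[of X "\<lambda>x. real (deg R Y x)" "\<lambda>_. c"] assms by auto

lemma few_high_degree:
  assumes "symp R" "finite X" "finite Y" "\<And>x. x \<in> X \<Longrightarrow> real (deg R Y x) \<le> c"
  shows "l * real (card {y\<in>Y. l < real (deg R X y)}) \<le> real (card X) * c"
proof -
  have "(\<Sum>y\<in>Y. real (deg R X y)) = (\<Sum>x\<in>X. real (deg R Y x))"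
    using sum_deg_swap[OF assms(1,2,3)] by (metis of_nat_sum)
  then show ?thesis
    using markov_card[of Y "\<lambda>y. real (deg R X y)" l] sum_deg_le[of X R Y c] assms by auto
qed

text \<open>Sparseness seen from \<open>X\<close> passes to half of \<open>Y\<close> at the cost of
  a factor two, by counting the pairs from both sides and applying Markov's inequality.\<close>

lemma half_low_degree:
  assumes "symp R" "finite X" "finite Y" "\<And>x. x \<in> X \<Longrightarrow> real (deg R Y x) \<le> c * real (card Y)" "0 \<le> c"
  shows "real (card Y) / 2 \<le> real (card {y\<in>Y. real (deg R X y) \<le> 2 * c * real (card X)})"
proof -
  have "(\<Sum>y\<in>Y. real (deg R X y)) = (\<Sum>x\<in>X. real (deg R Y x))"
    using sum_deg_swap[OF assms(1,2,3)] by (metis of_nat_sum)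
  also have "\<dots> \<le> real (card X) * (c * real (card Y))" by (rule sum_deg_le) (use assms in auto)
  finally have "(\<Sum>y\<in>Y. real (deg R X y)) \<le> (c * real (card X)) * real (card Y)"
    by (simp add: algebra_simps)
  from markov_half[OF assms(3) _ this] show ?thesis using assms(5) by (simp add: mult.assoc)
qed

text \<open>If every \<open>x\<close> fails at some index, the failure sets cover \<open>X\<close>,
  and one of them has at least the average share.\<close>

lemma exists_good_or_sparse:
  fixes Y :: "'i \<Rightarrow> 'a set" and f :: "'i \<Rightarrow> 'a \<Rightarrow> real"
  assumes "finite I" "finite X"
  shows "(\<exists>x\<in>X. \<forall>i\<in>I. c i \<le> f i x) \<or> X = {} \<or>
    (\<exists>i\<in>I. real (card X) \<le> real (card I) * real (card {x\<in>X. f i x < c i}))"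
proof (rule ccontr)
  assume neg: "\<not> ?thesis"
  then have "X \<subseteq> (\<Union>i\<in>I. {x\<in>X. f i x < c i})" by (auto simp: not_le)
  then have "card X \<le> card (\<Union>i\<in>I. {x\<in>X. f i x < c i})" using assms by (intro card_mono) auto
  also have "\<dots> \<le> (\<Sum>i\<in>I. card {x\<in>X. f i x < c i})" by (rule card_UN_le) (rule assms)
  finally have "real (card X) \<le> real (\<Sum>i\<in>I. card {x\<in>X. f i x < c i})" by (rule of_nat_mono)
  then have 1: "real (card X) \<le> (\<Sum>i\<in>I. real (card {x\<in>X. f i x < c i}))" by simp
  have ne: "I \<noteq> {}" using neg by auto
  have "(\<Sum>i\<in>I. real (card I) * real (card {x\<in>X. f i x < c i})) < (\<Sum>i\<in>I. real (card X))"
  proof (rule sum_strict_mono)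
    fix i assume "i \<in> I"
    then show "real (card I) * real (card {x\<in>X. f i x < c i}) < real (card X)" using neg by (meson not_le)
  qed (use ne assms in auto)
  then have "real (card I) * (\<Sum>i\<in>I. real (card {x\<in>X. f i x < c i})) < real (card I) * real (card X)"
    by (simp add: sum_distrib_left)
  with 1 show False using mult_left_mono[OF 1, of "real (card I)"] by linarith
qed

section \<open>Embedding an induced path or finding a sparse pair\<close>

text \<open>One-sided, so that it survives passing to a subset of \<open>A\<close>; the vertices of
  \<open>B\<close> are controlled by averaging.\<close>

definition sparse_to :: "('a \<Rightarrow> 'a \<Rightarrow> bool) \<Rightarrow> real \<Rightarrow> 'a set \<Rightarrow> 'a set \<Rightarrow> bool" where
  "sparse_to R e A B \<longleftrightarrow> (\<forall>a\<in>A. real (deg R B a) \<le> e * real (card B))"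

lemma Suc_le_two_power: "real (Suc h) \<le> 2 ^ h"
  by (metis of_nat_le_iff of_nat_power of_nat_numeral Suc_leI less_exp)

text \<open>Greedy embedding: the first vertex is chosen so that every later part keeps a fraction
  \<open>e\<close> with the prescribed adjacency, and the construction continues there. If no choice
  works, averaging gives a later part to which a large share of the first part is sparse, in the
  relation or in its complement.\<close>

lemma embed_or_sparse_pair:
  fixes V :: "nat \<Rightarrow> 'a set" and P :: "nat \<Rightarrow> nat \<Rightarrow> bool" and e p :: real
  assumes "0 < e" "e \<le> 1/2" "0 < p"
    and "\<And>i. i \<le> h \<Longrightarrow> finite (V i)" "\<And>i. i \<le> h \<Longrightarrow> p \<le> real (card (V i))"
    and "\<And>i j. i < j \<Longrightarrow> j \<le> h \<Longrightarrow> V i \<inter> V j = {}"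
  shows "(\<exists>x. (\<forall>i\<le>h. x i \<in> V i) \<and> (\<forall>i j. i < j \<longrightarrow> j \<le> h \<longrightarrow> E (x i) (x j) = P i j)) \<or>
    (\<exists>i j A B. i < j \<and> j \<le> h \<and> A \<subseteq> V i \<and> B \<subseteq> V j \<and> e ^ (h - 1) * p \<le> real (card A) \<and>
       e ^ (h - 1) * p \<le> real (card B) \<and> (sparse_to E e A B \<or> sparse_to (compl_rel E) e A B))"
  using assms(3-)
proof (induction h arbitrary: V P p)
  case 0
  then have "V 0 \<noteq> {}" by (metis card.empty less_le_not_le of_nat_0 order.refl)
  then obtain a where "a \<in> V 0" by auto
  then show ?case by (intro disjI1 exI[of _ "\<lambda>_. a"]) auto
next
  case (Suc h)
  \<comment> \<open>The relation that the pattern demands between the vertices \<open>0\<close> and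
    \<open>i\<close>.\<close>
  define R where "R = (\<lambda>i. if P 0 i then E else compl_rel E)"
  have fin0: "finite (V 0)" and c0: "p \<le> real (card (V 0))" using Suc.prems by auto
  then have ne0: "V 0 \<noteq> {}" using Suc.prems(1) by auto
  have c: "card {1..Suc h} = Suc h" by simp
  from exists_good_or_sparse[of "{1..Suc h}" "V 0" "\<lambda>i. e * real (card (V i))" "\<lambda>i x. real (deg (R i) (V i) x)",
      OF finite_atLeastAtMost fin0, unfolded c] ne0
  consider (good) x where "x \<in> V 0" "\<forall>i\<in>{1..Suc h}. e * real (card (V i)) \<le> real (deg (R i) (V i) x)"
    | (bad) i where "i \<in> {1..Suc h}"
       "real (card (V 0)) \<le> real (Suc h) * real (card {x\<in>V 0. real (deg (R i) (V i) x) < e * real (card (V i))})"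
    by blast
  then show ?case
  proof cases
    case good
    define V' where "V' = (\<lambda>i. {y \<in> V (Suc i). R (Suc i) x y})"
    have c': "e * p \<le> real (card (V' i))" if "i \<le> h" for i
    proof -
      have "e * p \<le> e * real (card (V (Suc i)))" using Suc.prems(3)[of "Suc i"] that assms(1) by simp
      also have "\<dots> \<le> real (card (V' i))" using good(2) that unfolding V'_def deg_def by auto
      finally show ?thesis .
    qed
    have d': "V' i \<inter> V' j = {}" if "i < j" "j \<le> h" for i j
      using Suc.prems(4)[of "Suc i" "Suc j"] that unfolding V'_def by auto
    have f': "finite (V' i)" if "i \<le> h" for i
      using Suc.prems(2)[of "Suc i"] that unfolding V'_def by auto
    from Suc.IH[of "e * p" V' "\<lambda>i j. P (Suc i) (Suc j)", OF _ f' c' d'] assms(1) Suc.prems(1)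
    consider (emb) y where "\<forall>i\<le>h. y i \<in> V' i" "\<forall>i j. i < j \<longrightarrow> j \<le> h \<longrightarrow> E (y i) (y j) = P (Suc i) (Suc j)"
      | (pair) i j A B where "i < j" "j \<le> h" "A \<subseteq> V' i" "B \<subseteq> V' j" "e ^ (h - 1) * (e * p) \<le> real (card A)"
       "e ^ (h - 1) * (e * p) \<le> real (card B)" "sparse_to E e A B \<or> sparse_to (compl_rel E) e A B"
      by auto
    then show ?thesis
    proof cases
      case emb
      define z where "z = (\<lambda>i. case i of 0 \<Rightarrow> x | Suc k \<Rightarrow> y k)"
      have in_z: "z i \<in> V i" if "i \<le> Suc h" for i
        using that emb(1) good(1) unfolding z_def V'_def by (auto split: nat.split)
      have "E (z i) (z j) = P i j" if "i < j" "j \<le> Suc h" for i j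
      proof (cases i)
        case 0
        obtain k where k: "j = Suc k" using \<open>i < j\<close> by (cases j) auto
        have "R j x (y k)" using emb(1) that k unfolding V'_def by auto
        then show ?thesis using 0 k unfolding z_def R_def compl_rel_def by (auto split: if_splits)
      next
        case (Suc i')
        obtain k where k: "j = Suc k" using \<open>i < j\<close> by (cases j) auto
        show ?thesis using emb(2) that Suc k unfolding z_def by auto
      qed
      then show ?thesis using in_z by blast
    next
      case pair
      \<comment> \<open>A pair \<open>i < j \<le> h\<close> forces \<open>h\<close> to be positive,
        so \<open>h - 1\<close> is not truncated and the round costs exactly one factor
        \<open>e\<close>.\<close>
      have "h \<ge> 1" using pair by auto
      then have eq: "e ^ (h - 1) * (e * p) = e ^ (Suc h - 1) * p" by (cases h) (auto simp: algebra_simps)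
      have "A \<subseteq> V (Suc i)" "B \<subseteq> V (Suc j)" using pair(3,4) unfolding V'_def by auto
      moreover have "Suc i < Suc j" "Suc j \<le> Suc h" using pair(1,2) by auto
      ultimately show ?thesis using pair(5-7) unfolding eq by blast
    qed
  next
    case bad
    define A where "A = {x\<in>V 0. real (deg (R i) (V i) x) < e * real (card (V i))}"
    \<comment> \<open>The share \<open>1 / Suc h\<close> left by averaging is at least
      \<open>(1/2) ^ h\<close>, and \<open>e \<le> 1/2\<close> puts this above the permitted
      \<open>e ^ h\<close>.\<close>
    have "p \<le> 2 ^ h * real (card A)"
      using bad(2) c0 Suc_le_two_power[of h] mult_right_mono[of "real (Suc h)" "2^h" "real (card A)"]
      unfolding A_def by linarith
    then have "p * (1/2)^h \<le> real (card A)" by (simp add: field_simps power_one_over)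
    moreover have "e ^ h * p \<le> (1/2)^h * p"
      using assms(1,2) Suc.prems(1) by (intro mult_right_mono power_mono) auto
    ultimately have 1: "e ^ h * p \<le> real (card A)" by (simp add: algebra_simps)
    have "e ^ h * p \<le> 1 * p" using assms(1,2) Suc.prems(1) by (intro mult_right_mono power_le_one) auto
    then have 2: "e ^ h * p \<le> real (card (V i))" using Suc.prems(3)[of i] bad(1) by simp
    have "sparse_to (R i) e A (V i)" unfolding sparse_to_def A_def by auto
    then have "sparse_to E e A (V i) \<or> sparse_to (compl_rel E) e A (V i)"
      unfolding R_def by (auto split: if_splits)
    moreover have "0 < i" "i \<le> Suc h" "A \<subseteq> V 0" using bad(1) unfolding A_def by auto
    ultimately show ?thesis using 1 2 by (metis diff_Suc_1 order_refl)
  qed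
qed

lemma disjoint_parts:
  assumes "finite U" "m * p \<le> card U"
  shows "\<exists>V. (\<forall>i<m. V i \<subseteq> U \<and> card (V i) = p) \<and> (\<forall>i j. i < j \<longrightarrow> j < m \<longrightarrow> V i \<inter> V j = {})"
proof -
  obtain f where f: "bij_betw f {..<card U} U"
    using assms(1) ex_bij_betw_nat_finite by (metis atLeast0LessThan)
  define V where "V = (\<lambda>i. f ` {i * p..<Suc i * p})"
  have sub: "{i * p..<Suc i * p} \<subseteq> {..<card U}" if "i < m" for i
  proof -
    have "Suc i * p \<le> m * p" using that by (intro mult_right_mono) auto
    then show ?thesis using assms(2) by auto
  qed
  have inj: "inj_on f {..<card U}" using f by (simp add: bij_betw_def)
  have "V i \<subseteq> U" if "i < m" for i
    using sub[OF that] f unfolding V_def bij_betw_def by blast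
  moreover have "card (V i) = p" if "i < m" for i
    unfolding V_def using inj_on_subset[OF inj sub[OF that]] by (simp add: card_image)
  moreover have "V i \<inter> V j = {}" if "i < j" "j < m" for i j
  proof -
    have "Suc i * p \<le> j * p" using that by (intro mult_right_mono) auto
    then have "{i * p..<Suc i * p} \<inter> {j * p..<Suc j * p} = {}" by auto
    then show ?thesis unfolding V_def
      using inj_on_image_Int[OF inj sub sub, of i j] that by auto
  qed
  ultimately show ?thesis by blast
qed

text \<open>Five equal parts with the adjacency pattern of the path: an embedding would be an
  induced P5, so a sparse pair results, and \<open>h = 4\<close> gives the power
  \<open>e ^ 3\<close>.\<close>

lemma p5_sparse_pair:
  assumes "finite U" "symp E" "p5_free E U" "0 < e" "e \<le> 1/2" "5 \<le> card U"
  obtains A B where "A \<subseteq> U" "B \<subseteq> U" "A \<inter> B = {}"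
    "e ^ 3 * real (card U) / 10 \<le> real (card A)" "e ^ 3 * real (card U) / 10 \<le> real (card B)"
    "sparse_to E e A B \<or> sparse_to (compl_rel E) e A B"
proof -
  define p where "p = card U div 5"
  have "5 * p \<le> card U" unfolding p_def by simp
  from disjoint_parts[OF assms(1) this] obtain V where
    V: "(\<forall>i<(5::nat). V i \<subseteq> U \<and> card (V i) = p) \<and> (\<forall>i j. i < j \<longrightarrow> j < 5 \<longrightarrow> V i \<inter> V j = {})" ..
  then have V: "\<And>i. i < 5 \<Longrightarrow> V i \<subseteq> U \<and> card (V i) = p" "\<And>i j. i < j \<Longrightarrow> j < 5 \<Longrightarrow> V i \<inter> V j = {}"
    by simp_all
  \<comment> \<open>With at least five vertices, rounding down costs at most a factor two.\<close>
  have "card U \<le> 10 * p" "0 < p" using assms(6) unfolding p_def by presburger+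
  then have pr: "real (card U) / 10 \<le> real p" and p0: "0 < real p" by linarith+
  have fV: "finite (V i)" if "i \<le> 4" for i
    using V(1)[of i] that assms(1) finite_subset[of "V i" U] by simp
  have cV: "real p \<le> real (card (V i))" if "i \<le> 4" for i using V(1)[of i] that by simp
  have dV: "V i \<inter> V j = {}" if "i < j" "j \<le> 4" for i j using V(2)[of i j] that by simp
  have "(\<exists>x. (\<forall>i\<le>(4::nat). x i \<in> V i) \<and> (\<forall>i j. i < j \<longrightarrow> j \<le> 4 \<longrightarrow> E (x i) (x j) = (j = Suc i))) \<or>
    (\<exists>i j A B. i < j \<and> j \<le> (4::nat) \<and> A \<subseteq> V i \<and> B \<subseteq> V j \<and> e ^ (4 - 1) * real p \<le> real (card A) \<and>
       e ^ (4 - 1) * real p \<le> real (card B) \<and> (sparse_to E e A B \<or> sparse_to (compl_rel E) e A B))" (is "?emb \<or> ?pair")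
    by (rule embed_or_sparse_pair) (use assms(4,5) p0 fV cV dV in auto)
  then show ?thesis
  proof
    assume ?emb
    then obtain x where emb: "\<forall>i\<le>(4::nat). x i \<in> V i" "\<forall>i j. i < j \<longrightarrow> j \<le> 4 \<longrightarrow> E (x i) (x j) = (j = Suc i)"
      by blast
    have "x 0 \<in> U" "x 1 \<in> U" "x 2 \<in> U" "x 3 \<in> U" "x 4 \<in> U"
      using emb(1) V(1)[of 0] V(1)[of 1] V(1)[of 2] V(1)[of 3] V(1)[of 4] by (auto intro: subsetD)
    moreover have "E (x 0) (x 1)" "E (x 1) (x 2)" "E (x 2) (x 3)" "E (x 3) (x 4)"
      "\<not> E (x 0) (x 2)" "\<not> E (x 0) (x 3)" "\<not> E (x 0) (x 4)" "\<not> E (x 1) (x 3)" "\<not> E (x 1) (x 4)" "\<not> E (x 2) (x 4)"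
      by (simp_all add: emb(2))
    ultimately have False using assms(3) unfolding p5_free_def by blast
    then show ?thesis ..
  next
    assume ?pair
    then obtain i j A B where pair: "i < j" "j \<le> (4::nat)" "A \<subseteq> V i" "B \<subseteq> V j" "e ^ (4 - 1) * p \<le> real (card A)"
       "e ^ (4 - 1) * p \<le> real (card B)" and sp: "sparse_to E e A B \<or> sparse_to (compl_rel E) e A B"
      by blast
    have "e ^ 3 * (real (card U) / 10) \<le> e ^ 3 * p" using pr assms(4) by (intro mult_left_mono) auto
    then have "e ^ 3 * real (card U) / 10 \<le> real (card A)" "e ^ 3 * real (card U) / 10 \<le> real (card B)"
      using pair(5,6) by simp_all
    moreover have "A \<subseteq> U" "B \<subseteq> U" "A \<inter> B = {}"
      using pair(1-4) V(1)[of i] V(1)[of j] V(2)[of i j] by auto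
    ultimately show ?thesis using sp that by blast
  qed
qed

section \<open>Sparse or dense subsets\<close>

definition npairs :: "('a \<Rightarrow> 'a \<Rightarrow> bool) \<Rightarrow> 'a set \<Rightarrow> nat" where
  "npairs R W = (\<Sum>w\<in>W. deg R W w)"

lemma npairs_le: "finite W \<Longrightarrow> npairs R W \<le> card W * card W"
  unfolding npairs_def using sum_bounded_above[of W "deg R W" "card W"] deg_le_card[of W R] by auto

lemma npairs_Un:
  assumes "symp R" "finite A" "finite B" "A \<inter> B = {}"
  shows "npairs R (A \<union> B) = npairs R A + npairs R B + 2 * (\<Sum>b\<in>B. deg R A b)"
proof -
  have "npairs R (A \<union> B) = (\<Sum>w\<in>A. deg R (A \<union> B) w) + (\<Sum>w\<in>B. deg R (A \<union> B) w)"
    unfolding npairs_def using assms by (intro sum.union_disjoint) auto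
  also have "\<dots> = (\<Sum>w\<in>A. deg R A w) + (\<Sum>w\<in>A. deg R B w) + ((\<Sum>w\<in>B. deg R A w) + (\<Sum>w\<in>B. deg R B w))"
    using deg_Un_disjoint[of A B R] assms by (simp add: sum.distrib)
  also have "(\<Sum>w\<in>A. deg R B w) = (\<Sum>w\<in>B. deg R A w)" using assms by (intro sum_deg_swap)
  finally show ?thesis unfolding npairs_def by simp
qed

lemma symp_compl_rel: "symp E \<Longrightarrow> symp (compl_rel E)"
  unfolding compl_rel_def symp_def by blast

text \<open>Joining two equally large sparse sets across a sparse pair halves the diagonal contribution
  to the density.\<close>

lemma sparse_join:
  assumes "symp R" "finite A" "finite B" "A \<inter> B = {}" "card A = 2 ^ i * N" "card B = 2 ^ i * N" "0 \<le> e"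
    and A: "real (npairs R A) \<le> ((1/2) ^ i + 4 * e) * (real (card A))\<^sup>2"
    and B: "real (npairs R B) \<le> ((1/2) ^ i + 4 * e) * (real (card B))\<^sup>2"
    and AB: "\<And>b. b \<in> B \<Longrightarrow> real (deg R A b) \<le> 4 * e * real (card A)"
  shows "real (npairs R (A \<union> B)) \<le> ((1/2) ^ Suc i + 4 * e) * (real (card (A \<union> B)))\<^sup>2"
proof -
  define c where "c = real (card A)"
  have cB: "real (card B) = c" using assms by (simp add: c_def)
  have cU: "real (card (A \<union> B)) = 2 * c" using assms by (simp add: card_Un_disjoint c_def)
  have "real (\<Sum>b\<in>B. deg R A b) \<le> real (card B) * (4 * e * c)"
    using sum_deg_le[of B R A "4 * e * c"] AB by (simp add: c_def)
  then have "real (npairs R (A \<union> B)) \<le> 2 * (((1/2) ^ i + 4 * e) * c\<^sup>2) + 2 * (c * (4 * e * c))"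
    using A B cB npairs_Un[OF assms(1-4)] unfolding c_def[symmetric] by (simp add: algebra_simps)
  also have "\<dots> = ((1/2) ^ Suc i + 4 * e) * (2 * c)\<^sup>2" by (simp add: algebra_simps power2_eq_square)
  finally show ?thesis using cU by simp
qed

text \<open>\<open>W\<close> is to be thought of as \<open>2 ^ i\<close> blocks of \<open>N\<close>
  vertices: \<open>(1/2) ^ i\<close> allows for any density inside the blocks, \<open>4 * e\<close>
  for the sparse pairs between them.\<close>

definition density_set :: "('a \<Rightarrow> 'a \<Rightarrow> bool) \<Rightarrow> real \<Rightarrow> nat \<Rightarrow> nat \<Rightarrow> 'a set \<Rightarrow> bool" where
  "density_set R e N i W \<longleftrightarrow> card W = 2 ^ i * N \<and>
     real (npairs R W) \<le> ((1/2) ^ i + 4 * e) * (real (card W))\<^sup>2"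

lemma density_set_0: "finite W \<Longrightarrow> card W = N \<Longrightarrow> 0 \<le> e \<Longrightarrow> density_set R e N 0 W"
proof -
  assume a: "finite W" "card W = N" "0 \<le> e"
  have "real (npairs R W) \<le> real (card W * card W)" using npairs_le[OF a(1)] by (rule of_nat_mono)
  also have "\<dots> \<le> (1 + 4 * e) * (real (card W))\<^sup>2"
    using a by (simp add: power2_eq_square algebra_simps)
  finally show ?thesis using a unfolding density_set_def by simp
qed

text \<open>The set \<open>A'\<close> in \<open>A\<close> comes first; then half of \<open>B\<close>
  is sparse to \<open>A'\<close>, which is why \<open>B\<close> must be twice as large, and the
  second set is taken there. \<open>D\<close> is the opposite outcome, merely passed on, so that the
  step serves the relation and its complement alike.\<close>

lemma density_set_step:
  assumes "symp R" "finite U" "A \<subseteq> U" "B \<subseteq> U" "A \<inter> B = {}" "0 \<le> e" "sparse_to R e A B"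
    and IH: "\<And>U'. U' \<subseteq> U \<Longrightarrow> c \<le> real (card U') \<Longrightarrow> \<exists>W\<subseteq>U'. density_set R e N i W \<or> D W"
    and "c \<le> real (card A)" "2 * c \<le> real (card B)" "0 \<le> c"
  shows "\<exists>W\<subseteq>U. density_set R e N (Suc i) W \<or> D W"
proof -
  obtain A' where A': "A' \<subseteq> A" "density_set R e N i A' \<or> D A'" using IH[of A] assms by blast
  have fin: "finite A" "finite B" "finite A'" using assms A' by (meson finite_subset)+
  show ?thesis
  proof (cases "D A'")
    case True then show ?thesis using A'(1) assms(3) by blast
  next
    case False
    define B' where "B' = {b\<in>B. real (deg R A' b) \<le> 2 * e * real (card A')}"
    have "real (card B) / 2 \<le> real (card B')" unfolding B'_def
      using assms A' fin by (intro half_low_degree) (auto simp: sparse_to_def)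
    then have "c \<le> real (card B')" using assms(10) by linarith
    moreover have B'B: "B' \<subseteq> B" unfolding B'_def by auto
    ultimately obtain B'' where B'': "B'' \<subseteq> B'" "density_set R e N i B'' \<or> D B''"
      using IH[of B'] assms(4) by blast
    show ?thesis
    proof (cases "D B''")
      case True then show ?thesis using B''(1) B'B assms(4) by blast
    next
      case F: False
      have dis: "A' \<inter> B'' = {}" using assms(5) A'(1) B''(1) B'B by blast
      have finB: "finite B''" using B''(1) B'B fin(2) by (meson finite_subset)
      have ds: "density_set R e N i A'" "density_set R e N i B''" using A' B'' False F by auto
      have "real (npairs R (A' \<union> B'')) \<le> ((1/2) ^ Suc i + 4 * e) * (real (card (A' \<union> B'')))\<^sup>2"
      proof (rule sparse_join)
        show "real (deg R A' b) \<le> 4 * e * real (card A')" if "b \<in> B''" for b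
        proof -
          have "real (deg R A' b) \<le> 2 * e * real (card A')" using that B'' B'_def by auto
          also have "\<dots> \<le> 4 * e * real (card A')" using assms by (intro mult_right_mono) auto
          finally show ?thesis .
        qed
      qed (use ds assms fin finB dis in \<open>auto simp: density_set_def\<close>)
      moreover have "card (A' \<union> B'') = 2 ^ Suc i * N"
        using ds fin finB dis by (simp add: card_Un_disjoint density_set_def)
      moreover have "A' \<union> B'' \<subseteq> U" using A'(1) B''(1) B'B assms(3,4) by blast
      ultimately show ?thesis unfolding density_set_def by blast
    qed
  qed
qed

text \<open>A quantitative form of Roedl's theorem in the style of Fox and Sudakov.\<close>

lemma density_dichotomy:
  assumes "symp E" "p5_free E U" "finite U" "0 < e" "e \<le> 1/2" "1 \<le> N"
    "real N * (20 / e ^ 3) ^ (i + j) \<le> real (card U)"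
  shows "\<exists>W\<subseteq>U. density_set E e N i W \<or> density_set (compl_rel E) e N j W"
  using assms
proof (induction "i + j" arbitrary: U i j rule: less_induct)
  case less
  have e3: "1 \<le> 1 / e ^ 3" using less.prems by (simp add: power_le_one)
  \<comment> \<open>The sparse pair costs \<open>10 / e ^ 3\<close>, and the halving of one side
    another factor two.\<close>
  define K where "K = 20 / e ^ 3"
  have K: "20 \<le> K" using e3 unfolding K_def by simp
  show ?case
  proof (cases "i = 0 \<or> j = 0")
    case True
    have "real N * 1 \<le> real N * K ^ (i + j)" using K by (intro mult_left_mono one_le_power) auto
    then have "N \<le> card U" using less.prems(7) unfolding K_def by linarith
    then obtain W where "W \<subseteq> U" "card W = N" by (meson obtain_subset_with_card_n)
    then show ?thesis using density_set_0[of W N e] True less.prems by (metis finite_subset less_imp_le)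
  next
    case False
    define c where "c = real N * K ^ (i + j - 1)"
    have "K ^ (i + j) = K * K ^ (i + j - 1)" using False by (metis add_is_0 power_eq_if)
    then have cK: "c * K \<le> real (card U)" using less.prems(7) unfolding c_def K_def by (simp add: mult_ac)
    have "1 \<le> c" unfolding c_def using less.prems K one_le_power[of K "i+j-1"] mult_mono[of 1 "real N" 1 "K^(i+j-1)"] by simp
    then have "20 \<le> real (card U)" using cK K mult_mono[of 1 c 20 K] by simp
    then have "5 \<le> card U" by simp
    from p5_sparse_pair[OF less.prems(3,1,2,4,5) this] obtain A B where AB: "A \<subseteq> U" "B \<subseteq> U" "A \<inter> B = {}"
      "e ^ 3 * real (card U) / 10 \<le> real (card A)" "e ^ 3 * real (card U) / 10 \<le> real (card B)"
      "sparse_to E e A B \<or> sparse_to (compl_rel E) e A B" by metis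
    have "2 * c = e ^ 3 * (c * K) / 10" unfolding K_def using less.prems by simp
    also have "\<dots> \<le> e ^ 3 * real (card U) / 10"
      using cK less.prems by (intro divide_right_mono mult_left_mono) auto
    finally have c: "2 * c \<le> real (card A)" "2 * c \<le> real (card B)" using AB by auto
    \<comment> \<open>A pair sparse for \<open>E\<close> uses up one level of \<open>i\<close>, a
      pair sparse for the complement one level of \<open>j\<close>.\<close>
    have IH1: "\<exists>W\<subseteq>U'. density_set E e N (i - 1) W \<or> density_set (compl_rel E) e N j W"
      if "U' \<subseteq> U" "c \<le> real (card U')" for U'
    proof -
      have "i - 1 + j < i + j" using False by simp
      moreover have "i - 1 + j = i + j - 1" using False by simp
      then have "real N * (20 / e ^ 3) ^ (i - 1 + j) \<le> real (card U')" using that unfolding c_def K_def by simp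
      ultimately show ?thesis
        by (rule less.hyps[OF _ less.prems(1) p5_free_subset[OF less.prems(2) that(1)]
              finite_subset[OF that(1) less.prems(3)] less.prems(4-6)])
    qed
    have IH2: "\<exists>W\<subseteq>U'. density_set (compl_rel E) e N (j - 1) W \<or> density_set E e N i W"
      if "U' \<subseteq> U" "c \<le> real (card U')" for U'
    proof -
      have "i + (j - 1) < i + j" using False by simp
      moreover have "i + (j - 1) = i + j - 1" using False by simp
      then have "real N * (20 / e ^ 3) ^ (i + (j - 1)) \<le> real (card U')" using that unfolding c_def K_def by simp
      ultimately have "\<exists>W\<subseteq>U'. density_set E e N i W \<or> density_set (compl_rel E) e N (j - 1) W"
        by (rule less.hyps[OF _ less.prems(1) p5_free_subset[OF less.prems(2) that(1)]
              finite_subset[OF that(1) less.prems(3)] less.prems(4-6)])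
      then show ?thesis by blast
    qed
    have cA: "c \<le> real (card A)" and c0: "0 \<le> c" and e0: "0 \<le> e"
      using c \<open>1 \<le> c\<close> less.prems(4) by linarith+
    have ij: "Suc (i - 1) = i" "Suc (j - 1) = j" using False by auto
    from AB(6) show ?thesis
    proof
      assume "sparse_to E e A B"
      from density_set_step[OF less.prems(1,3) AB(1-3) e0 this IH1 cA c(2) c0]
      show ?thesis unfolding ij .
    next
      assume "sparse_to (compl_rel E) e A B"
      from density_set_step[OF symp_compl_rel[OF less.prems(1)] less.prems(3) AB(1-3) e0 this IH2 cA c(2) c0]
      show ?thesis unfolding ij by blast
    qed
  qed
qed

text \<open>Deleting the vertices above twice the average degree bounds every degree. At least half
  of \<open>W\<close> remains, which costs another factor two in the relative degree;
  \<open>1 \<le> i\<close> ensures that this half has \<open>N\<close> vertices.\<close>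

lemma density_set_low_degree:
  assumes "finite W" "density_set R e N i W" "1 \<le> i" "0 \<le> e" "(1/2) ^ i + 4 * e \<le> d"
  shows "\<exists>W'\<subseteq>W. N \<le> card W' \<and> (\<forall>w\<in>W'. real (deg R W' w) \<le> 4 * d * real (card W'))"
proof -
  have "0 \<le> (1/2::real) ^ i" by simp
  then have d0: "0 \<le> d" using assms by linarith
  define W' where "W' = {w\<in>W. real (deg R W w) \<le> 2 * (d * real (card W))}"
  have "real (npairs R W) \<le> ((1/2) ^ i + 4 * e) * (real (card W))\<^sup>2"
    using assms(2) unfolding density_set_def by blast
  also have "\<dots> \<le> d * (real (card W))\<^sup>2" using assms by (intro mult_right_mono) auto
  finally have "(\<Sum>w\<in>W. real (deg R W w)) \<le> d * real (card W) * real (card W)"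
    unfolding npairs_def by (simp add: power2_eq_square algebra_simps)
  then have half: "real (card W) / 2 \<le> real (card W')" unfolding W'_def
    using assms(1) d0 by (intro markov_half) auto
  obtain i' where "i = Suc i'" using assms(3) by (cases i) auto
  then have "2 * N \<le> card W" using assms(2) unfolding density_set_def by simp
  then have "N \<le> card W'" using half by linarith
  moreover have "real (deg R W' w) \<le> 4 * d * real (card W')" if "w \<in> W'" for w
  proof -
    have "real (deg R W' w) \<le> real (deg R W w)" using deg_mono[OF assms(1), of W' R w] W'_def by auto
    also have "\<dots> \<le> 2 * (d * real (card W))" using that W'_def by auto
    also have "\<dots> \<le> 4 * d * real (card W')" using mult_left_mono[OF half d0] by simp
    finally show ?thesis .
  qed
  moreover have "W' \<subseteq> W" unfolding W'_def by auto
  ultimately show ?thesis by blast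
qed

lemma sparse_or_dense_subset:
  assumes "symp E" "p5_free E U" "finite U" "3 \<le> k" "1 \<le> N"
    "real N * 2 ^ ((5 * k + 19) * (9 * k + 29)) \<le> real (card U)"
  shows "\<exists>W\<subseteq>U. N \<le> card W \<and> ((\<forall>w\<in>W. real (deg E W w) \<le> real (card W) / 8 ^ (k + 1)) \<or>
     (\<forall>w\<in>W. real (deg (compl_rel E) W w) \<le> real (card W) / 2 ^ (2 * k + 6)))"
proof -
  \<comment> \<open>The densities become at most \<open>5 * (1/2) ^ i\<close> and
    \<open>5 * (1/2) ^ j\<close>; the second needs \<open>e \<le> (1/2) ^ j\<close>, hence
    \<open>3 \<le> k\<close>. With the factor 4 for single degrees and \<open>20 \<le> 2 ^ 5\<close>
    both targets are met. Moreover \<open>i + j = 5 * k + 19\<close> and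
    \<open>20 / e ^ 3 \<le> 2 ^ (9 * k + 29)\<close>.\<close>
  define i j e where "i = 3 * k + 8" and "j = 2 * k + 11" and "e = (1/2::real) ^ i"
  have "20 / e ^ 3 = 20 * 2 ^ (i * 3)" unfolding e_def by (simp add: power_one_over power_mult)
  also have "\<dots> \<le> 2 ^ 5 * 2 ^ (i * 3)" by simp
  also have "\<dots> = (2::real) ^ (5 + i * 3)" by (rule power_add[symmetric])
  also have "5 + i * 3 = 9 * k + 29" by (simp add: i_def)
  finally have "(20 / e ^ 3) ^ (i + j) \<le> (2 ^ (9 * k + 29)) ^ (i + j)"
    by (rule power_mono) (simp add: e_def)
  also have "\<dots> = 2 ^ ((5 * k + 19) * (9 * k + 29))"
    unfolding i_def j_def power_mult[symmetric] by (simp add: algebra_simps)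
  finally have "real N * (20 / e ^ 3) ^ (i + j) \<le> real N * 2 ^ ((5 * k + 19) * (9 * k + 29))"
    by (rule mult_left_mono) simp
  then have big: "real N * (20 / e ^ 3) ^ (i + j) \<le> real (card U)" using assms(6) by linarith
  have e: "0 < e" "e \<le> 1/2" unfolding e_def using power_decreasing[of 1 i "1/2::real"] by (auto simp: i_def)
  from density_dichotomy[OF assms(1-3) e assms(5) big]
  obtain W where W: "W \<subseteq> U" "density_set E e N i W \<or> density_set (compl_rel E) e N j W" by blast
  have finW: "finite W" using W(1) assms(3) finite_subset by blast
  have ei: "(1/2) ^ i + 4 * e \<le> 5 * (1/2) ^ i" unfolding e_def by simp
  have "e \<le> (1/2) ^ j" unfolding e_def i_def j_def by (rule power_decreasing) (use assms(4) in auto)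
  then have ej: "(1/2) ^ j + 4 * e \<le> 5 * (1/2) ^ j" by simp
  have "4 * (5 * (1/2) ^ i) \<le> 32 * (1/2::real) ^ i" by simp
  also have "\<dots> = 1 / 8 ^ (k + 1)" unfolding i_def by (simp add: power_add power_mult power_one_over)
  finally have di: "4 * (5 * (1/2) ^ i) \<le> 1 / (8::real) ^ (k + 1)" .
  have "4 * (5 * (1/2) ^ j) \<le> 32 * (1/2::real) ^ j" by simp
  also have "\<dots> = 1 / 2 ^ (2 * k + 6)" unfolding j_def by (simp add: power_add power_one_over)
  finally have dj: "4 * (5 * (1/2) ^ j) \<le> 1 / (2::real) ^ (2 * k + 6)" .
  from W(2) show ?thesis
  proof
    assume ds: "density_set E e N i W"
    obtain W' where W': "W' \<subseteq> W" "N \<le> card W'" "\<forall>w\<in>W'. real (deg E W' w) \<le> 4 * (5 * (1/2) ^ i) * real (card W')"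
      using density_set_low_degree[OF finW ds _ _ ei] e by (auto simp: i_def)
    have "real (deg E W' w) \<le> real (card W') / 8 ^ (k + 1)" if "w \<in> W'" for w
      using W'(3) that mult_right_mono[OF di, of "real (card W')"] by fastforce
    then show ?thesis using W' W(1) by (meson order_trans)
  next
    assume ds: "density_set (compl_rel E) e N j W"
    obtain W' where W': "W' \<subseteq> W" "N \<le> card W'"
      "\<forall>w\<in>W'. real (deg (compl_rel E) W' w) \<le> 4 * (5 * (1/2) ^ j) * real (card W')"
      using density_set_low_degree[OF finW ds _ _ ej] e by (auto simp: j_def)
    have "real (deg (compl_rel E) W' w) \<le> real (card W') / 2 ^ (2 * k + 6)" if "w \<in> W'" for w
      using W'(3) that mult_right_mono[OF dj, of "real (card W')"] by fastforce
    then show ?thesis using W' W(1) by (meson order_trans)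
  qed
qed

section \<open>Sparse graphs and connected components\<close>

definition anti :: "('a \<Rightarrow> 'a \<Rightarrow> bool) \<Rightarrow> 'a set \<Rightarrow> 'a set \<Rightarrow> bool" where
  "anti E A B \<longleftrightarrow> (\<forall>a\<in>A. \<forall>b\<in>B. \<not> E a b)"

text \<open>Connectedness through cuts: what is needed is an edge leaving a given subset or, if
  connectedness fails, a split.\<close>

definition connected_on :: "('a \<Rightarrow> 'a \<Rightarrow> bool) \<Rightarrow> 'a set \<Rightarrow> bool" where
  "connected_on E C \<longleftrightarrow> C \<noteq> {} \<and> (\<forall>X\<subseteq>C. X \<noteq> {} \<longrightarrow> X \<noteq> C \<longrightarrow> (\<exists>x\<in>X. \<exists>y\<in>C - X. E x y))"

text \<open>Take a smallest set of more than \<open>card U - p\<close> vertices that no edge of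
  \<open>U\<close> leaves. If it is disconnected, its two pieces are closed as well and, being
  smaller, have at most \<open>card U - p\<close> vertices; as it has more than \<open>2 * p\<close>
  vertices, one piece has at least \<open>p\<close>.\<close>

lemma split_or_giant_component:
  assumes "symp E" "finite U" "0 < p" "3 * p \<le> real (card U)"
  shows "(\<exists>A\<subseteq>U. p \<le> real (card A) \<and> p \<le> real (card (U - A)) \<and> anti E A (U - A)) \<or>
    (\<exists>C\<subseteq>U. connected_on E C \<and> anti E C (U - C) \<and> real (card U) - p < real (card C))"
proof (rule disjCI)
  assume no: "\<not> (\<exists>C\<subseteq>U. connected_on E C \<and> anti E C (U - C) \<and> real (card U) - p < real (card C))"
  have sym: "E x y \<Longrightarrow> E y x" for x y using assms(1) by (meson sympD)
  define P where "P = (\<lambda>C. C \<subseteq> U \<and> anti E C (U - C) \<and> real (card U) - p < real (card C))"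
  have PU: "P U" unfolding P_def anti_def using assms by auto
  obtain C where C: "P C" and min: "\<And>D. P D \<Longrightarrow> card C \<le> card D"
    using ex_has_least_nat[of P U card] PU by blast
  have finC: "finite C" using C assms(2) unfolding P_def by (meson finite_subset)
  have "C \<noteq> {}" using C assms(3,4) unfolding P_def by auto
  moreover have "\<not> connected_on E C" using no C unfolding P_def by blast
  ultimately obtain X where X: "X \<subseteq> C" "X \<noteq> {}" "X \<noteq> C" "\<forall>x\<in>X. \<forall>y\<in>C - X. \<not> E x y"
    unfolding connected_on_def by blast
  have closed: "anti E X (U - X)" "anti E (C - X) (U - (C - X))"
    using X C sym unfolding P_def anti_def by blast+
  have XU: "X \<subseteq> U" "C - X \<subseteq> U" using X C unfolding P_def by auto
  have lt: "card X < card C" "card (C - X) < card C" using X finC by (auto intro!: psubset_card_mono)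
  have "card C = card X + card (C - X)" using X finC by (metis card_Diff_subset card_mono finite_subset le_add_diff_inverse)
  then have "p \<le> real (card X) \<or> p \<le> real (card (C - X))" using C assms(4) unfolding P_def by linarith
  moreover have "\<not> P X" "\<not> P (C - X)" using lt min by (meson not_le)+
  ultimately obtain A where A: "A \<subseteq> U" "anti E A (U - A)" "p \<le> real (card A)" "real (card A) \<le> real (card U) - p"
    using closed XU unfolding P_def by (meson not_le)
  have "card (U - A) = card U - card A" using A(1) assms(2) by (meson card_Diff_subset finite_subset)
  then have "p \<le> real (card (U - A))" using A card_mono[OF assms(2) A(1)] by (simp add: of_nat_diff)
  then show "\<exists>A\<subseteq>U. p \<le> real (card A) \<and> p \<le> real (card (U - A)) \<and> anti E A (U - A)"
    using A by blast
qed

lemma connected_on_boundary: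
  assumes "connected_on E C" "X \<subseteq> C" "X \<noteq> {}" "X \<noteq> C"
  obtains x y where "x \<in> X" "y \<in> C" "y \<notin> X" "E x y"
  using assms unfolding connected_on_def by blast

text \<open>Gyarfas' path argument: following giant components one can grow an induced path
  until it has five vertices.\<close>

lemma sparse_p5_free_split:
  assumes "symp E" "irreflp E" "finite U" "p5_free E U" "8 \<le> card U"
    and d: "\<And>u. u \<in> U \<Longrightarrow> real (deg E U u) \<le> real (card U) / 8"
  obtains A B where "A \<subseteq> U" "B \<subseteq> U" "A \<inter> B = {}" "anti E A B"
    "real (card U) / 8 \<le> real (card A)" "real (card U) / 8 \<le> real (card B)"
proof (rule ccontr)
  assume "\<not> thesis"
  then have no: "\<not> (A \<subseteq> U \<and> B \<subseteq> U \<and> A \<inter> B = {} \<and> anti E A B \<and>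
      real (card U) / 8 \<le> real (card A) \<and> real (card U) / 8 \<le> real (card B))" for A B
    using that by blast
  have sym: "E x y \<Longrightarrow> E y x" for x y using assms(1) by (meson sympD)
  have irr: "\<not> E x x" for x using assms(2) by (meson irreflpD)
  define m where "m = real (card U)"
  have m8: "8 \<le> m" using assms(5) unfolding m_def by simp
  \<comment> \<open>As no large anticomplete pair exists, each sufficiently large subset has a
    component missing fewer than \<open>m / 8\<close> of its vertices.\<close>
  have giant: "\<exists>C\<subseteq>S. connected_on E C \<and> anti E C (S - C) \<and> real (card S) - m / 8 < real (card C)"
    if "S \<subseteq> U" "3 * m / 8 \<le> real (card S)" for S
  proof -
    have fS: "finite S" using that assms(3) finite_subset by blast
    have "\<not> (\<exists>A\<subseteq>S. m / 8 \<le> real (card A) \<and> m / 8 \<le> real (card (S - A)) \<and> anti E A (S - A))"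
    proof
      assume "\<exists>A\<subseteq>S. m / 8 \<le> real (card A) \<and> m / 8 \<le> real (card (S - A)) \<and> anti E A (S - A)"
      then obtain A where A: "A \<subseteq> S" "m / 8 \<le> real (card A)" "m / 8 \<le> real (card (S - A))" "anti E A (S - A)"
        by blast
      have "A \<subseteq> U" "S - A \<subseteq> U" "A \<inter> (S - A) = {}" using A(1) that(1) by auto
      then show False using no[of A "S - A"] A(2-4) unfolding m_def by simp
    qed
    moreover have "(\<exists>A\<subseteq>S. m / 8 \<le> real (card A) \<and> m / 8 \<le> real (card (S - A)) \<and> anti E A (S - A)) \<or>
      (\<exists>C\<subseteq>S. connected_on E C \<and> anti E C (S - C) \<and> real (card S) - m / 8 < real (card C))"
      by (rule split_or_giant_component) (use assms(1) fS m8 that in auto)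
    ultimately show ?thesis by blast
  qed
  have nbr: "real (card {u\<in>S. E v u}) \<le> m / 8" if "S \<subseteq> U" "v \<in> U" for S v
    using d[OF that(2)] deg_mono[OF assms(3) that(1), of E v] unfolding m_def deg_def by linarith
  have remove: "real (card S) - m / 8 \<le> real (card {u\<in>S. \<not> E v u})" if "S \<subseteq> U" "v \<in> U" for S v
  proof -
    have "finite S" using that assms(3) finite_subset by blast
    then have "card {u\<in>S. E v u} + card {u\<in>S. \<not> E v u} = card S"
      by (subst card_Un_disjoint[symmetric]) (auto intro!: arg_cong[where f = card])
    then show ?thesis using nbr[OF that] by linarith
  qed
  obtain C0 where C0: "C0 \<subseteq> U" "connected_on E C0" "m - m / 8 < real (card C0)"
    using giant[of U] m8 unfolding m_def by auto
  then obtain v1 where v1: "v1 \<in> C0" unfolding connected_on_def by auto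
  \<comment> \<open>Each of the first two path vertices costs \<open>m / 8\<close> for its
    neighbours and \<open>m / 8\<close> for the passage to a giant component; the additional 1 is
    for \<open>v1\<close> itself.\<close>
  define S1 where "S1 = {u\<in>C0. \<not> E v1 u} - {v1}"
  have "real (card S1) \<ge> real (card {u\<in>C0. \<not> E v1 u}) - 1"
    unfolding S1_def using card_Diff1_le[of _ v1] card_Diff_singleton_if[of "{u\<in>C0. \<not> E v1 u}" v1] by (auto split: if_splits)
  then have c1: "m - 2 * m / 8 - 1 \<le> real (card S1)" using remove[of C0 v1] C0 v1 by (auto simp: field_simps)
  have S1: "S1 \<subseteq> U" "S1 \<subseteq> C0" using C0 unfolding S1_def by auto
  obtain C1 where C1: "C1 \<subseteq> S1" "connected_on E C1" "anti E C1 (S1 - C1)" "m - 3 * m / 8 - 1 < real (card C1)"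
    using giant[OF S1(1)] c1 m8 by fastforce
  have ne1: "C1 \<noteq> {}" using C1(2) unfolding connected_on_def by simp
  have "v1 \<notin> C1" using C1(1) unfolding S1_def by auto
  then have "C1 \<noteq> C0" using v1 by auto
  with connected_on_boundary[OF C0(2), of C1] ne1 C1(1) S1(2) obtain x v2 where
    v2: "x \<in> C1" "v2 \<in> C0" "v2 \<notin> C1" "E x v2" by blast
  \<comment> \<open>Vertices of \<open>S1\<close> outside the component \<open>C1\<close> have no
    neighbour in it. So \<open>v2\<close> was removed as a neighbour of \<open>v1\<close>, and is
    the next vertex of the path.\<close>
  have "v2 \<notin> S1" using C1(3) v2 unfolding anti_def by blast
  moreover have "v2 \<noteq> v1" using v2 C1(1) sym unfolding S1_def by auto
  ultimately have e12: "E v1 v2" using v2(2) unfolding S1_def by auto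
  define S2 where "S2 = {u\<in>C1. \<not> E v2 u}"
  have C1U: "C1 \<subseteq> U" using C1 S1 by auto
  have v2U: "v2 \<in> U" using v2 C0 by auto
  \<comment> \<open>Here \<open>8 \<le> m\<close> is exactly what leaves the
    \<open>3 * m / 8\<close> vertices that \<open>giant\<close> demands.\<close>
  have c2: "m - 4 * m / 8 - 1 \<le> real (card S2)" unfolding S2_def using remove[OF C1U v2U] C1(4) by linarith
  have "S2 \<subseteq> U" using C1U unfolding S2_def by auto
  from giant[OF this] c2 m8 obtain C2 where C2: "C2 \<subseteq> S2" "connected_on E C2" "anti E C2 (S2 - C2)"
    "m - 5 * m / 8 - 1 < real (card C2)" by fastforce
  have ne2: "C2 \<noteq> {}" using C2(2) unfolding connected_on_def by simp
  have C21: "C2 \<subseteq> C1" using C2 unfolding S2_def by auto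
  have "x \<notin> S2" using v2 sym unfolding S2_def by auto
  then have "C2 \<noteq> C1" using C2(1) v2(1) by auto
  with connected_on_boundary[OF C1(2) C21 ne2] obtain y v3 where
    v3: "y \<in> C2" "v3 \<in> C1" "v3 \<notin> C2" "E y v3" by metis
  have "v3 \<notin> S2" using C2(3) v3 unfolding anti_def by blast
  then have e23: "E v2 v3" using v3(2) unfolding S2_def by auto
  \<comment> \<open>\<open>C2\<close> contains no neighbour of \<open>v1\<close> or
    \<open>v2\<close>, so an edge of \<open>C2\<close> leaving the neighbourhood of
    \<open>v3\<close> completes the induced path.\<close>
  define N3 where "N3 = {u\<in>C2. E v3 u}"
  have "real (card N3) \<le> m / 8" unfolding N3_def by (rule nbr) (use C21 C1U v3 in auto)
  then have "N3 \<noteq> C2" using C2(4) m8 by auto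
  moreover have "N3 \<noteq> {}" using v3 sym unfolding N3_def by auto
  ultimately obtain v4 v5 where v45: "v4 \<in> N3" "v5 \<in> C2" "v5 \<notin> N3" "E v4 v5"
    using connected_on_boundary[OF C2(2), of N3] unfolding N3_def by blast
  have "v4 \<in> C2" "E v3 v4" "\<not> E v3 v5" using v45 unfolding N3_def by auto
  moreover have "\<not> E v1 v3" "\<not> E v1 v4" "\<not> E v1 v5" "\<not> E v2 v4" "\<not> E v2 v5"
    using v3(2) v45(2) \<open>v4 \<in> C2\<close> C21 C1(1) C2(1) unfolding S1_def S2_def by auto
  moreover have "v1 \<in> U" "v3 \<in> U" "v4 \<in> U" "v5 \<in> U"
    using v1 C0 v3 C1U C21 v45(2) \<open>v4 \<in> C2\<close> by auto
  ultimately show False using assms(4) v2U e12 e23 v45(4) unfolding p5_free_def by blast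
qed

lemma cog_union_anti:
  assumes "cog E A" "cog E B" "A \<inter> B = {}" "anti E A B"
  shows "cog E (A \<union> B)"
  using assms unfolding anti_def by (intro cog_union) auto

lemma anti_subset: "anti E A B \<Longrightarrow> A' \<subseteq> A \<Longrightarrow> B' \<subseteq> B \<Longrightarrow> anti E A' B'"
  unfolding anti_def by blast

text \<open>Splitting \<open>k\<close> times gives \<open>2 ^ k\<close> pairwise anticomplete sets.
  Each split costs a factor 8, so all of them still have at least \<open>r\<close> vertices, and
  their cographs unite.\<close>

lemma cog_from_splits:
  assumes "finite V" "rich E V M q" "M \<le> r" "U \<subseteq> V" "8 ^ k * r \<le> real (card U)" "0 \<le> r"
    and "\<And>S. S \<subseteq> U \<Longrightarrow> r \<le> real (card S) \<Longrightarrow> \<exists>A B. A \<subseteq> S \<and> B \<subseteq> S \<and> A \<inter> B = {} \<and> anti E A B \<and>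
      real (card S) / 8 \<le> real (card A) \<and> real (card S) / 8 \<le> real (card B)"
  shows "\<exists>Q\<subseteq>U. cog E Q \<and> 2 ^ k * q \<le> real (card Q)"
  using assms(4,5,7)
proof (induction k arbitrary: U)
  case 0
  then show ?case using assms(2,3) unfolding rich_def by auto
next
  case (Suc k)
  have "1 \<le> (8::real) ^ Suc k" by (rule one_le_power) simp
  from mult_right_mono[OF this assms(6)] have "r \<le> 8 ^ Suc k * r" by simp
  then have "r \<le> real (card U)" using Suc.prems by linarith
  from Suc.prems(3)[OF order_refl this] obtain A B where AB: "A \<subseteq> U" "B \<subseteq> U" "A \<inter> B = {}" "anti E A B"
    "real (card U) / 8 \<le> real (card A)" "real (card U) / 8 \<le> real (card B)" by blast
  have sz: "8 ^ k * r \<le> real (card A)" "8 ^ k * r \<le> real (card B)" using AB(5,6) Suc.prems(2) by auto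
  from Suc.IH[OF subset_trans[OF AB(1) Suc.prems(1)] sz(1) Suc.prems(3)[OF subset_trans[OF _ AB(1)]]]
  obtain Q where Q: "Q \<subseteq> A" "cog E Q" "2 ^ k * q \<le> real (card Q)" by blast
  from Suc.IH[OF subset_trans[OF AB(2) Suc.prems(1)] sz(2) Suc.prems(3)[OF subset_trans[OF _ AB(2)]]]
  obtain Q' where Q': "Q' \<subseteq> B" "cog E Q'" "2 ^ k * q \<le> real (card Q')" by blast
  have fin: "finite Q" "finite Q'" using Q(1) Q'(1) AB(1,2) Suc.prems(1) assms(1) by (meson finite_subset)+
  have dis: "Q \<inter> Q' = {}" using Q(1) Q'(1) AB(3) by auto
  have "cog E (Q \<union> Q')" by (rule cog_union_anti) (use Q Q' dis anti_subset[OF AB(4)] in auto)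
  moreover have "2 ^ Suc k * q \<le> real (card (Q \<union> Q'))"
    using Q(3) Q'(3) fin dis by (simp add: card_Un_disjoint)
  ultimately show ?case using Q(1) Q'(1) AB(1,2) by (meson Un_least order_trans)
qed

text \<open>Every set to be split has at least \<open>card W / 8 ^ k\<close> vertices. The degree
  bound carries one factor 8 more, so degrees stay below an eighth of each such set and the path
  argument applies again.\<close>

lemma cog_from_sparse:
  assumes "symp E" "irreflp E" "finite V" "p5_free E V" "rich E V M q" "W \<subseteq> V"
    "8 ^ k * M \<le> real (card W)" "8 ^ k * 8 \<le> real (card W)"
    "\<And>w. w \<in> W \<Longrightarrow> real (deg E W w) \<le> real (card W) / 8 ^ (k + 1)"
  shows "\<exists>Q\<subseteq>W. cog E Q \<and> 2 ^ k * q \<le> real (card Q)"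
proof (rule cog_from_splits[OF assms(3,5) _ assms(6), where r = "real (card W) / 8 ^ k"])
  fix S assume S: "S \<subseteq> W" "real (card W) / 8 ^ k \<le> real (card S)"
  have fW: "finite W" using assms(3,6) finite_subset by blast
  have "8 \<le> real (card W) / 8 ^ k" using assms(8) by (simp add: field_simps)
  then have c8: "8 \<le> card S" using S(2) by linarith
  have low: "real (deg E S u) \<le> real (card S) / 8" if "u \<in> S" for u
  proof -
    have "real (deg E S u) \<le> real (deg E W u)" using deg_mono[OF fW S(1)] by simp
    also have "\<dots> \<le> real (card W) / 8 ^ (k + 1)" using assms(9) that S(1) by blast
    also have "\<dots> \<le> real (card S) / 8" using divide_right_mono[OF S(2), of 8] by simp
    finally show ?thesis .
  qed
  have "finite S" "p5_free E S"
    using finite_subset[OF S(1) fW] p5_free_subset[OF assms(4) subset_trans[OF S(1) assms(6)]] by simp_all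
  from sparse_p5_free_split[OF assms(1,2) this c8 low]
  obtain A B where "A \<subseteq> S" "B \<subseteq> S" "A \<inter> B = {}" "anti E A B"
    "real (card S) / 8 \<le> real (card A)" "real (card S) / 8 \<le> real (card B)" by blast
  then show "\<exists>A B. A \<subseteq> S \<and> B \<subseteq> S \<and> A \<inter> B = {} \<and> anti E A B \<and>
      real (card S) / 8 \<le> real (card A) \<and> real (card S) / 8 \<le> real (card B)"
    by blast
qed (use assms(7) in \<open>auto simp: field_simps\<close>)

lemma connected_on_insert:
  assumes "symp E" "connected_on E C" "c \<in> C" "E c y"
  shows "connected_on E (insert y C)"
  unfolding connected_on_def
proof (intro conjI allI impI)
  have sym: "E y c" using assms(1,4) by (meson sympD)
  fix X assume X: "X \<subseteq> insert y C" "X \<noteq> {}" "X \<noteq> insert y C"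
  show "\<exists>x\<in>X. \<exists>z\<in>insert y C - X. E x z"
  proof (cases "X \<inter> C = {} \<or> C \<subseteq> X")
    case True
    then show ?thesis using X assms(3,4) sym by blast
  next
    case False
    then obtain a b where "a \<in> X \<inter> C" "b \<in> C" "b \<notin> X \<inter> C" "E a b"
      using connected_on_boundary[OF assms(2), of "X \<inter> C"] by (metis Int_lower2 inf.absorb_iff2)
    then show ?thesis by blast
  qed
qed simp

text \<open>If all components are small, no subset of at least \<open>card S / 8 ^ k\<close>
  vertices has a giant component, so each of them splits and iterated splitting gives a large
  cograph.\<close>

lemma cog_or_large_component:
  assumes "symp E" "finite V" "rich E V M q" "S \<subseteq> V" "8 ^ k * M \<le> real (card S)" "S \<noteq> {}"
  shows "(\<exists>Q\<subseteq>S. cog E Q \<and> 2 ^ k * q \<le> real (card Q)) \<or>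
    (\<exists>C\<subseteq>S. connected_on E C \<and> anti E C (S - C) \<and> real (card S) / 8 ^ (k + 1) \<le> real (card C))"
proof (rule disjCI)
  assume no: "\<not> (\<exists>C\<subseteq>S. connected_on E C \<and> anti E C (S - C) \<and> real (card S) / 8 ^ (k + 1) \<le> real (card C))"
  have fS: "finite S" using assms(2,4) finite_subset by blast
  have small: "real (card C) < real (card S) / 8 ^ (k + 1)" if C: "C \<subseteq> S" "connected_on E C" for C
  proof -
    \<comment> \<open>A largest connected subset cannot be enlarged by a neighbour, so it is a
      component and falls under \<open>no\<close>; every other connected subset is at most as
      large.\<close>
    define P where "P = (\<lambda>C. C \<subseteq> S \<and> connected_on E C)"
    have "\<forall>D. P D \<longrightarrow> card D < Suc (card S)"
      unfolding P_def using card_mono[OF fS] by (meson le_imp_less_Suc)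
    then obtain D where D: "P D" and max: "\<forall>D'. P D' \<longrightarrow> card D' \<le> card D"
      using ex_has_greatest_nat[of P C card "Suc (card S)"] C unfolding P_def by blast
    have fD: "finite D" using D fS unfolding P_def by (meson finite_subset)
    have "anti E D (S - D)"
      unfolding anti_def
    proof (intro ballI notI)
      fix d y assume dy: "d \<in> D" "y \<in> S - D" "E d y"
      then have "P (insert y D)" using D connected_on_insert[OF assms(1)] unfolding P_def by blast
      then have "card (insert y D) \<le> card D" using max by blast
      then show False using dy fD by simp
    qed
    then have "real (card D) < real (card S) / 8 ^ (k + 1)" using no D unfolding P_def by force
    moreover have "card C \<le> card D" using max C unfolding P_def by blast
    ultimately show ?thesis by linarith
  qed
  show "\<exists>Q\<subseteq>S. cog E Q \<and> 2 ^ k * q \<le> real (card Q)"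
  proof (rule cog_from_splits[OF assms(2,3) _ assms(4), where r = "real (card S) / 8 ^ k"])
    fix S' assume S': "S' \<subseteq> S" "real (card S) / 8 ^ k \<le> real (card S')"
    have fS': "finite S'" using S'(1) fS finite_subset by blast
    have "0 < card S" using assms(6) fS by (simp add: card_gt_0_iff)
    then have "0 < real (card S) / 8 ^ k" by simp
    then have pos: "0 < real (card S') / 8" using S'(2) by linarith
    have le: "real (card S) / 8 ^ (k + 1) \<le> real (card S') / 8" using divide_right_mono[OF S'(2), of 8] by simp
    have "\<not> (\<exists>C\<subseteq>S'. connected_on E C \<and> anti E C (S' - C) \<and> real (card S') - real (card S') / 8 < real (card C))"
    proof
      assume "\<exists>C\<subseteq>S'. connected_on E C \<and> anti E C (S' - C) \<and> real (card S') - real (card S') / 8 < real (card C)"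
      then obtain C where C: "C \<subseteq> S'" "connected_on E C" "real (card S') - real (card S') / 8 < real (card C)"
        by blast
      show False using small[OF subset_trans[OF C(1) S'(1)] C(2)] le pos C(3) by linarith
    qed
    then obtain A where "A \<subseteq> S'" "real (card S') / 8 \<le> real (card A)" "real (card S') / 8 \<le> real (card (S' - A))"
      "anti E A (S' - A)"
      using split_or_giant_component[OF assms(1) fS' pos] by auto
    then show "\<exists>A B. A \<subseteq> S' \<and> B \<subseteq> S' \<and> A \<inter> B = {} \<and> anti E A B \<and>
      real (card S') / 8 \<le> real (card A) \<and> real (card S') / 8 \<le> real (card B)" by blast
  qed (use assms(5) in \<open>auto simp: field_simps\<close>)
qed

text \<open>If \<open>r\<close> had a neighbour and a non-neighbour in \<open>C\<close>, it would have an adjacent such pair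
  \<open>u''\<close>, \<open>u\<close> and \<open>v - b - r - u'' - u\<close> would be an induced path.\<close>

lemma component_homogeneous:
  assumes "symp E" "p5_free E V" "A \<subseteq> V" "v \<in> V" "b \<in> V" "anti E {v} A" "E v b"
    "connected_on E C" "C \<subseteq> {a\<in>A. \<not> E b a}" "anti E C ({a\<in>A. \<not> E b a} - C)" "r \<in> A - C"
  shows "(\<forall>c\<in>C. E c r) \<or> (\<forall>c\<in>C. \<not> E c r)"
proof (rule ccontr)
  assume neg: "\<not> ?thesis"
  have sym: "E x y \<Longrightarrow> E y x" for x y using assms(1) by (meson sympD)
  define X where "X = {c\<in>C. E c r}"
  have "X \<subseteq> C" "X \<noteq> {}" "X \<noteq> C" using neg unfolding X_def by auto
  from connected_on_boundary[OF assms(8) this] obtain c u where cu: "c \<in> X" "u \<in> C" "u \<notin> X" "E c u"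
    by metis
  have "E b r" using neg assms(10,11) unfolding anti_def by blast
  have "r \<in> V" "c \<in> V" "u \<in> V" using assms(3,9,11) cu unfolding X_def by auto
  moreover have "\<not> E v r" "\<not> E v c" "\<not> E v u" "\<not> E b c" "\<not> E b u" "\<not> E r u" "E r c"
    using assms(6,9,11) cu sym unfolding X_def anti_def by auto
  ultimately show False using assms(2,4,5,7) \<open>E b r\<close> cu(4) unfolding p5_free_def by blast
qed

section \<open>Dense graphs\<close>

lemma cog_clique:
  assumes "finite Q" "\<And>x y. x \<in> Q \<Longrightarrow> y \<in> Q \<Longrightarrow> x \<noteq> y \<Longrightarrow> E x y"
  shows "cog E Q"
  using assms
proof (induction Q rule: finite_induct)
  case empty
  show ?case by (rule cog_empty)
next
  case (insert x F)
  have "cog E ({x} \<union> F)"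
  proof (rule cog_union)
    show "cog E {x}" by (rule cog_single)
    show "cog E F" using insert by blast
    show "{x} \<inter> F = {}" using insert(2) by simp
    have "\<forall>b\<in>F. E x b" using insert(2) insert.prems by blast
    then show "(\<forall>a\<in>{x}. \<forall>b\<in>F. E a b) \<or> (\<forall>a\<in>{x}. \<forall>b\<in>F. \<not> E a b)"
      by simp
  qed
  then show ?case by simp
qed

lemma cog_union_complete:
  assumes "cog E A" "cog E B" "A \<inter> B = {}" "\<And>a b. a \<in> A \<Longrightarrow> b \<in> B \<Longrightarrow> E a b"
  shows "cog E (A \<union> B)"
  using assms by (intro cog_union) auto

text \<open>Each vertex outside a largest clique has a non-neighbour in it. So the clique vertices
  with their non-neighbours cover \<open>Y\<close>, each accounting for at most \<open>1 / T\<close>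
  of it.\<close>

lemma clique_or_large_codegree:
  assumes "symp E" "finite Y" "Y \<noteq> {}" "0 < T"
    "\<And>y. y \<in> Y \<Longrightarrow> 1 + real (deg (compl_rel E) Y y) \<le> real (card Y) / T"
  shows "\<exists>Q\<subseteq>Y. cog E Q \<and> T \<le> real (card Q)"
proof -
  have sym: "E x y \<Longrightarrow> E y x" for x y using assms(1) by (meson sympD)
  define P where "P = (\<lambda>I. I \<subseteq> Y \<and> (\<forall>x\<in>I. \<forall>y\<in>I. x \<noteq> y \<longrightarrow> E x y))"
  have "\<forall>D. P D \<longrightarrow> card D < Suc (card Y)"
    unfolding P_def using card_mono[OF assms(2)] by (meson le_imp_less_Suc)
  moreover have "P {}" unfolding P_def by simp
  ultimately obtain I where I: "P I" and max: "\<forall>D. P D \<longrightarrow> card D \<le> card I"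
    using ex_has_greatest_nat[of P "{}" card "Suc (card Y)"] by blast
  have sub: "I \<subseteq> Y" and cl: "\<And>x y. x \<in> I \<Longrightarrow> y \<in> I \<Longrightarrow> x \<noteq> y \<Longrightarrow> E x y"
    using I unfolding P_def by auto
  have fI: "finite I" using sub assms(2) finite_subset by blast
  have "Y \<subseteq> (\<Union>i\<in>I. insert i {u\<in>Y. compl_rel E i u})"
  proof
    fix y assume y: "y \<in> Y"
    show "y \<in> (\<Union>i\<in>I. insert i {u\<in>Y. compl_rel E i u})"
    proof (rule ccontr)
      assume no: "y \<notin> (\<Union>i\<in>I. insert i {u\<in>Y. compl_rel E i u})"
      then have yI: "y \<notin> I" by auto
      have "E i y" if "i \<in> I" for i using no that y yI unfolding compl_rel_def by auto
      then have "P (insert y I)" using y sub cl sym unfolding P_def by auto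
      then have "card (insert y I) \<le> card I" using max by blast
      then show False using yI fI by simp
    qed
  qed
  then have "card Y \<le> card (\<Union>i\<in>I. insert i {u\<in>Y. compl_rel E i u})"
    using fI assms(2) by (intro card_mono) auto
  also have "\<dots> \<le> (\<Sum>i\<in>I. card (insert i {u\<in>Y. compl_rel E i u}))" by (rule card_UN_le[OF fI])
  also have "\<dots> \<le> (\<Sum>i\<in>I. 1 + deg (compl_rel E) Y i)"
    unfolding deg_def using assms(2) by (intro sum_mono) (simp add: card_insert_if)
  finally have "real (card Y) \<le> real (\<Sum>i\<in>I. 1 + deg (compl_rel E) Y i)" by (rule of_nat_mono)
  also have "\<dots> = (\<Sum>i\<in>I. 1 + real (deg (compl_rel E) Y i))" by simp
  also have "\<dots> \<le> (\<Sum>i\<in>I. real (card Y) / T)" using sub by (intro sum_mono assms(5)) auto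
  finally have "real (card Y) * T \<le> real (card Y) * real (card I)" using assms(4) by (simp add: field_simps)
  moreover have "0 < real (card Y)" using assms(2,3) by (simp add: card_gt_0_iff)
  ultimately have "T \<le> real (card I)" by simp
  moreover have "cog E I" by (rule cog_clique[OF fI]) (rule cl)
  ultimately show ?thesis using sub by blast
qed

section \<open>Rounds inside the non-neighbourhood of a vertex\<close>

text \<open>The non-neighbours of \<open>b\<close> in \<open>Z\<close> either contain a cograph of
  size \<open>T\<close>, which is excluded, or have a large component \<open>C\<close>, homogeneous
  to the rest of \<open>Z\<close>. \<open>Q\<close> is taken in \<open>C\<close>, and
  \<open>Z'\<close> consists of the vertices complete to \<open>C\<close>. Lost are only
  \<open>C\<close> and the non-neighbours of one vertex of \<open>C\<close>, each at most
  \<open>d * card A\<close>.\<close>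

lemma inner_step:
  assumes "symp E" "finite V" "p5_free E V" "rich E V M (T / 2 ^ k)" "0 < M"
    and "A \<subseteq> V" "v \<in> V" "Y \<subseteq> V" "anti E {v} A" "\<forall>b\<in>Y. E v b"
    and codeg: "\<And>a. a \<in> A \<Longrightarrow> real (deg (compl_rel E) A a) \<le> d * real (card A)"
    and "0 \<le> d" "0 \<le> \<theta>" "8 ^ (k + 1) * M \<le> \<theta> * (real (card A) / 2)"
    and "Z \<subseteq> A" "real (card A) / 2 \<le> real (card Z)"
    and no_cog: "\<not> (\<exists>Q\<subseteq>V. cog E Q \<and> T \<le> real (card Q))"
    and b: "b \<in> Y" "\<theta> * real (card Z) \<le> real (deg (compl_rel E) Z b)"
      "real (deg (compl_rel E) Z b) \<le> d * real (card Z)"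
  shows "\<exists>Q Z'. Q \<subseteq> Z \<and> cog E Q \<and> T / 2 ^ k \<le> real (card Q) \<and> Z' \<subseteq> Z \<and> Q \<inter> Z' = {} \<and>
    (\<forall>x\<in>Q. \<forall>z\<in>Z'. E x z) \<and> real (card Z) - 2 * d * real (card A) \<le> real (card Z')"
proof -
  have fA: "finite A" and fZ: "finite Z" using assms(2,6) \<open>Z \<subseteq> A\<close> by (meson finite_subset)+
  have ZV: "Z \<subseteq> V" using assms(6) \<open>Z \<subseteq> A\<close> by auto
  define S where "S = {a\<in>Z. \<not> E b a}"
  \<comment> \<open>\<open>v\<close> sees \<open>b\<close> but nothing in \<open>A\<close>. So
    \<open>b\<close> is outside \<open>Z\<close>, where \<open>compl_rel E b\<close> then is plain
    non-adjacency.\<close>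
  have "b \<notin> Z" using b(1) assms(9,10) \<open>Z \<subseteq> A\<close> unfolding anti_def by auto
  then have cS: "deg (compl_rel E) Z b = card S"
    unfolding deg_def S_def compl_rel_def by (intro arg_cong[where f = card]) auto
  have "\<theta> * (real (card A) / 2) \<le> \<theta> * real (card Z)" using assms(13,16) by (intro mult_left_mono)
  then have S_big: "8 ^ (k + 1) * M \<le> real (card S)" using b(2) assms(14) cS by linarith
  have "0 < 8 ^ (k + 1) * M" using assms(5) by simp
  then have "S \<noteq> {}" using S_big by force
  have "8 ^ k * M \<le> 8 ^ (k + 1) * M" using assms(5) by simp
  then have "8 ^ k * M \<le> real (card S)" using S_big by linarith
  moreover have SV: "S \<subseteq> V" using ZV unfolding S_def by auto
  ultimately have "(\<exists>Q\<subseteq>S. cog E Q \<and> 2 ^ k * (T / 2 ^ k) \<le> real (card Q)) \<or>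
    (\<exists>C\<subseteq>S. connected_on E C \<and> anti E C (S - C) \<and> real (card S) / 8 ^ (k + 1) \<le> real (card C))"
    using cog_or_large_component[OF assms(1,2,4)] \<open>S \<noteq> {}\<close> by blast
  moreover have "\<not> (\<exists>Q\<subseteq>S. cog E Q \<and> 2 ^ k * (T / 2 ^ k) \<le> real (card Q))"
  proof
    assume "\<exists>Q\<subseteq>S. cog E Q \<and> 2 ^ k * (T / 2 ^ k) \<le> real (card Q)"
    then obtain Q where "Q \<subseteq> S" "cog E Q" "2 ^ k * (T / 2 ^ k) \<le> real (card Q)" by blast
    then have "Q \<subseteq> V" "cog E Q" "T \<le> real (card Q)" using SV by auto
    then show False using no_cog by blast
  qed
  ultimately obtain C where C: "C \<subseteq> S" "connected_on E C" "anti E C (S - C)"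
    "real (card S) / 8 ^ (k + 1) \<le> real (card C)" by blast
  have "M \<le> real (card S) / 8 ^ (k + 1)" using S_big by (simp add: field_simps)
  then have "M \<le> real (card C)" using C(4) by linarith
  from richE[OF assms(4) subset_trans[OF C(1) SV] this] obtain Q where
    Q: "Q \<subseteq> C" "cog E Q" "T / 2 ^ k \<le> real (card Q)" by blast
  obtain c where c: "c \<in> C" using C(2) unfolding connected_on_def by auto
  \<comment> \<open>By homogeneity the single vertex \<open>c\<close> decides for all of
    \<open>C\<close>.\<close>
  define Z' where "Z' = {r\<in>Z - C. E c r}"
  have CZ: "C \<subseteq> Z" using C(1) unfolding S_def by auto
  have anti_vZ: "anti E {v} Z" using assms(9) \<open>Z \<subseteq> A\<close> unfolding anti_def by auto
  have bV: "b \<in> V" using b(1) assms(8) by auto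
  have vb: "E v b" using b(1) assms(10) by auto
  have compl: "E x z" if "x \<in> Q" "z \<in> Z'" for x z
  proof -
    have z: "z \<in> Z - C" "E c z" using that unfolding Z'_def by auto
    have "(\<forall>c\<in>C. E c z) \<or> (\<forall>c\<in>C. \<not> E c z)"
      by (rule component_homogeneous[OF assms(1,3) ZV assms(7) bV anti_vZ vb C(2) _ _ z(1)])
        (use C in \<open>auto simp: S_def\<close>)
    then show ?thesis using z(2) c that(1) Q(1) by blast
  qed
  have "Z \<subseteq> Z' \<union> C \<union> {r\<in>A. compl_rel E c r}"
    using \<open>Z \<subseteq> A\<close> c unfolding Z'_def compl_rel_def by auto
  then have "card Z \<le> card (Z' \<union> C \<union> {r\<in>A. compl_rel E c r})"
    using fZ fA CZ by (intro card_mono) (auto intro: finite_subset simp: Z'_def)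
  also have "\<dots> \<le> card Z' + card C + card {r\<in>A. compl_rel E c r}"
    by (meson add_right_mono card_Un_le order_trans)
  finally have "real (card Z) \<le> real (card Z') + real (card C) + real (deg (compl_rel E) A c)"
    unfolding deg_def by linarith
  moreover have "real (deg (compl_rel E) A c) \<le> d * real (card A)"
    using codeg c CZ \<open>Z \<subseteq> A\<close> by auto
  moreover have "real (card C) \<le> d * real (card A)"
  proof -
    have "card C \<le> card S" using C(1) fZ unfolding S_def by (intro card_mono) auto
    then have "real (card C) \<le> d * real (card Z)" using b(3) cS by linarith
    also have "\<dots> \<le> d * real (card A)"
      using card_mono[OF fA \<open>Z \<subseteq> A\<close>] assms(12) by (intro mult_left_mono) auto
    finally show ?thesis .
  qed
  ultimately have "real (card Z) - 2 * d * real (card A) \<le> real (card Z')" by linarith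
  moreover have "Q \<subseteq> Z" "Z' \<subseteq> Z" "Q \<inter> Z' = {}" using Q(1) CZ unfolding Z'_def by auto
  moreover have "\<forall>x\<in>Q. \<forall>z\<in>Z'. E x z" using compl by blast
  ultimately show ?thesis using Q(2,3) by (intro exI[of _ Q] exI[of _ Z']) simp
qed

text \<open>Its failure is exactly the existence of a vertex \<open>b\<close> as
  \<open>inner_step\<close> requires.\<close>

definition gap_pair :: "('a \<Rightarrow> 'a \<Rightarrow> bool) \<Rightarrow> real \<Rightarrow> real \<Rightarrow> 'a set \<Rightarrow> 'a set \<Rightarrow> bool" where
  "gap_pair E \<theta> d X Y \<longleftrightarrow> (\<forall>b\<in>Y. real (deg (compl_rel E) X b) < \<theta> * real (card X) \<or>
     d * real (card X) < real (deg (compl_rel E) X b))"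

lemma join_rounds:
  assumes "finite V" "Q \<subseteq> Z" "cog E Q" "q \<le> real (card Q)" "Z' \<subseteq> Z" "Z \<subseteq> V" "Q \<inter> Z' = {}"
    "\<forall>x\<in>Q. \<forall>z\<in>Z'. E x z" "Q' \<subseteq> Z'" "cog E Q'" "real j * q \<le> real (card Q')"
  shows "Q \<union> Q' \<subseteq> Z \<and> cog E (Q \<union> Q') \<and> real (Suc j) * q \<le> real (card (Q \<union> Q'))"
proof -
  have fin: "finite Q" "finite Q'" using assms by (meson finite_subset)+
  have dis: "Q \<inter> Q' = {}" using assms(7,9) by auto
  have "cog E (Q \<union> Q')" by (rule cog_union_complete[OF assms(3,10) dis]) (use assms(8,9) in blast)
  then show ?thesis using assms(2,4,5,9,11) fin dis by (auto simp: card_Un_disjoint algebra_simps)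
qed

text \<open>The surplus of \<open>Z\<close> over half of \<open>A\<close> is a budget from which
  each round takes \<open>2 * d * card A\<close>. Each cograph is complete to what remains for later
  rounds, so all of them unite.\<close>

lemma inner_rounds:
  assumes "symp E" "finite V" "p5_free E V" "rich E V M (T / 2 ^ k)" "0 < M"
    and "A \<subseteq> V" "v \<in> V" "Y \<subseteq> V" "anti E {v} A" "\<forall>b\<in>Y. E v b"
    and "\<And>a. a \<in> A \<Longrightarrow> real (deg (compl_rel E) A a) \<le> d * real (card A)"
    and "0 \<le> d" "0 \<le> \<theta>" "8 ^ (k + 1) * M \<le> \<theta> * (real (card A) / 2)"
    and "\<not> (\<exists>Q\<subseteq>V. cog E Q \<and> T \<le> real (card Q))"
    and "Z \<subseteq> A" "real (card A) / 2 + real j * (2 * d * real (card A)) \<le> real (card Z)"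
  shows "(\<exists>X\<subseteq>Z. real (card A) / 2 \<le> real (card X) \<and> gap_pair E \<theta> d X Y) \<or>
    (\<exists>Q\<subseteq>Z. cog E Q \<and> real j * (T / 2 ^ k) \<le> real (card Q))"
  using assms(16,17)
proof (induction j arbitrary: Z)
  case 0
  have "{} \<subseteq> Z \<and> cog E {} \<and> real 0 * (T / 2 ^ k) \<le> real (card {})" by (simp add: cog_empty)
  then show ?case by blast
next
  case (Suc j)
  have "0 \<le> real (Suc j) * (2 * d * real (card A))" using assms(12) by simp
  then have half: "real (card A) / 2 \<le> real (card Z)" using Suc.prems(2) by linarith
  show ?case
  proof (cases "gap_pair E \<theta> d Z Y")
    case True
    then show ?thesis using half by blast
  next
    case False
    then obtain b where "b \<in> Y" "\<theta> * real (card Z) \<le> real (deg (compl_rel E) Z b)"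
      "real (deg (compl_rel E) Z b) \<le> d * real (card Z)" unfolding gap_pair_def by (meson not_le)
    from inner_step[OF assms(1-10) assms(11) assms(12-14) Suc.prems(1) half assms(15) this]
    obtain Q Z' where Q: "Q \<subseteq> Z" "cog E Q" "T / 2 ^ k \<le> real (card Q)" "Z' \<subseteq> Z" "Q \<inter> Z' = {}"
      "\<forall>x\<in>Q. \<forall>z\<in>Z'. E x z" "real (card Z) - 2 * d * real (card A) \<le> real (card Z')"
        by blast
    have "real (card A) / 2 + real j * (2 * d * real (card A)) \<le> real (card Z')"
      using Q(7) Suc.prems(2) by (simp add: algebra_simps)
    from Suc.IH[OF subset_trans[OF Q(4) Suc.prems(1)] this] show ?thesis
    proof
      assume "\<exists>X\<subseteq>Z'. real (card A) / 2 \<le> real (card X) \<and> gap_pair E \<theta> d X Y"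
      then show ?thesis using Q(4) by (meson subset_trans)
    next
      assume "\<exists>Q\<subseteq>Z'. cog E Q \<and> real j * (T / 2 ^ k) \<le> real (card Q)"
      then obtain Q' where "Q' \<subseteq> Z'" "cog E Q'" "real j * (T / 2 ^ k) \<le> real (card Q')" by blast
      from join_rounds[OF assms(2) Q(1-4) subset_trans[OF Suc.prems(1) assms(6)] Q(5,6) this]
      show ?thesis by blast
    qed
  qed
qed

section \<open>Rounds in a dense graph\<close>

text \<open>The factor by which \<open>sparse_or_dense_subset\<close> shrinks a set.\<close>

definition loss :: "nat \<Rightarrow> real" where
  "loss k = 2 ^ ((5 * k + 19) * (9 * k + 29))"

lemma loss_ge_1: "1 \<le> loss k"
  unfolding loss_def by (rule one_le_power) simp

lemma large_codegree_vertex: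
  assumes "symp E" "finite Y" "Y \<noteq> {}" "0 < T" "\<not> (\<exists>Q\<subseteq>Y. cog E Q \<and> T \<le> real (card Q))"
  obtains v where "v \<in> Y" "real (card Y) / T - 1 < real (deg (compl_rel E) Y v)"
proof -
  have "\<exists>y\<in>Y. \<not> 1 + real (deg (compl_rel E) Y y) \<le> real (card Y) / T"
    using clique_or_large_codegree[OF assms(1-4)] assms(5) by blast
  then obtain y where "y \<in> Y" "\<not> 1 + real (deg (compl_rel E) Y y) \<le> real (card Y) / T" by blast
  then show ?thesis by (intro that[of y]) auto
qed

text \<open>A cograph in \<open>X\<close> has fewer than \<open>T\<close> vertices, so it misses only few vertices of \<open>Y\<close> if
  the pair is sparse in the complement on the scale \<open>1 / T\<close>.\<close>

lemma extend_over_gap: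
  assumes "symp E" "finite V" "rich E V M q" "X \<subseteq> V" "Y \<subseteq> V" "X \<inter> Y = {}" "0 < T" "0 \<le> d"
    and deg: "\<And>y. y \<in> Y \<Longrightarrow> real (deg (compl_rel E) X y) \<le> d / (2 * T) * real (card X)"
    and "2 * M \<le> real (card X)" "\<not> (\<exists>Q\<subseteq>V. cog E Q \<and> T \<le> real (card Q))"
  shows "\<exists>Q Y'. Q \<subseteq> X \<and> cog E Q \<and> q \<le> real (card Q) \<and> Y' \<subseteq> Y \<and> (\<forall>x\<in>Q. \<forall>y\<in>Y'. E x y) \<and>
    real (card Y) - d * real (card Y) \<le> real (card Y')"
proof -
  have fX: "finite X" and fY: "finite Y" using assms(2,4,5) by (meson finite_subset)+
  \<comment> \<open>The bound equals \<open>d / T\<close> times the size of \<open>Y\<close>, so the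
    fewer than \<open>T\<close> vertices of a cograph in \<open>X2\<close> together miss at most a
    share \<open>d\<close> of \<open>Y\<close>.\<close>
  define X2 where "X2 = {x\<in>X. real (deg (compl_rel E) Y x) \<le> 2 * (d / (2 * T)) * real (card Y)}"
  have "real (card X) / 2 \<le> real (card X2)" unfolding X2_def
    using symp_compl_rel[OF assms(1)] fX fY deg assms(7,8) by (intro half_low_degree) auto
  then have "M \<le> real (card X2)" using assms(10) by linarith
  have X2X: "X2 \<subseteq> X" unfolding X2_def by auto
  from richE[OF assms(3) subset_trans[OF X2X assms(4)] \<open>M \<le> real (card X2)\<close>]
  obtain Q where Q: "Q \<subseteq> X2" "cog E Q" "q \<le> real (card Q)" by blast
  have QX: "Q \<subseteq> X" using Q(1) X2X by auto
  have "\<not> T \<le> real (card Q)" using assms(11) Q(2) subset_trans[OF QX assms(4)] by blast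
  then have cQ: "real (card Q) \<le> T" by simp
  have fQ: "finite Q" using QX fX finite_subset by blast
  define Y' where "Y' = {y\<in>Y. \<forall>x\<in>Q. E x y}"
  have "Y \<subseteq> Y' \<union> (\<Union>x\<in>Q. {y\<in>Y. compl_rel E x y})"
    using QX assms(6) unfolding Y'_def compl_rel_def by auto
  then have "card Y \<le> card (Y' \<union> (\<Union>x\<in>Q. {y\<in>Y. compl_rel E x y}))"
    using fY fQ by (intro card_mono) (auto simp: Y'_def)
  also have "\<dots> \<le> card Y' + card (\<Union>x\<in>Q. {y\<in>Y. compl_rel E x y})" by (rule card_Un_le)
  also have "\<dots> \<le> card Y' + (\<Sum>x\<in>Q. deg (compl_rel E) Y x)"
    unfolding deg_def using card_UN_le[OF fQ] by (intro add_left_mono)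
  finally have "real (card Y) \<le> real (card Y' + (\<Sum>x\<in>Q. deg (compl_rel E) Y x))" by (rule of_nat_mono)
  then have "real (card Y) \<le> real (card Y') + (\<Sum>x\<in>Q. real (deg (compl_rel E) Y x))" by simp
  moreover have "(\<Sum>x\<in>Q. real (deg (compl_rel E) Y x)) \<le> real (card Q) * (2 * (d / (2 * T)) * real (card Y))"
    using Q(1) by (intro sum_deg_le) (auto simp: X2_def)
  moreover have "real (card Q) * (2 * (d / (2 * T)) * real (card Y)) \<le> T * (2 * (d / (2 * T)) * real (card Y))"
    using cQ assms(7,8) by (intro mult_right_mono) auto
  moreover have "T * (2 * (d / (2 * T)) * real (card Y)) = d * real (card Y)" using assms(7) by simp
  ultimately have "real (card Y) - d * real (card Y) \<le> real (card Y')" by linarith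
  moreover have "\<forall>x\<in>Q. \<forall>y\<in>Y'. E x y" "Y' \<subseteq> Y" unfolding Y'_def by auto
  ultimately show ?thesis using QX Q(2,3) by (intro exI[of _ Q] exI[of _ Y']) simp
qed

text \<open>Exceptions are \<open>v\<close>, its non-neighbours, and the vertices with more than
  \<open>d * card X\<close> non-neighbours in \<open>X\<close>; the gap rules out the middle range.
  Counting the non-adjacent pairs from \<open>X\<close> bounds the last kind by
  \<open>\<epsilon> * m / d\<close>.\<close>

lemma gap_exceptions:
  assumes "symp E" "finite Y" "X \<subseteq> Y" "X \<noteq> {}" "v \<in> Y" "0 < d"
    and codeg: "\<And>y. y \<in> Y \<Longrightarrow> real (deg (compl_rel E) Y y) \<le> \<epsilon> * m"
    and gap: "gap_pair E \<theta> d X {b\<in>Y. E v b}"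
  shows "real (card Y) - (1 + \<epsilon> * m + \<epsilon> * m / d) \<le>
    real (card {b\<in>Y. E v b \<and> real (deg (compl_rel E) X b) < \<theta> * real (card X)})"
    (is "_ \<le> real (card ?Y1)")
proof -
  have fX: "finite X" using assms(2,3) finite_subset by blast
  have cX: "0 < real (card X)" using fX assms(4) by (simp add: card_gt_0_iff)
  define H where "H = {b\<in>Y. d * real (card X) < real (deg (compl_rel E) X b)}"
  have "d * real (card X) * real (card H) \<le> real (card X) * (\<epsilon> * m)"
    unfolding H_def using symp_compl_rel[OF assms(1)] fX assms(2,3) codeg by (intro few_high_degree) auto
  then have "d * real (card H) \<le> \<epsilon> * m" using cX by (simp add: mult_ac)
  then have "real (card H) \<le> \<epsilon> * m / d" using assms(6) by (simp add: field_simps)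
  moreover have "Y \<subseteq> ?Y1 \<union> {v} \<union> {u\<in>Y. compl_rel E v u} \<union> H"
    using gap unfolding gap_pair_def H_def compl_rel_def by auto
  then have "card Y \<le> card (?Y1 \<union> {v} \<union> {u\<in>Y. compl_rel E v u} \<union> H)"
    using assms(2) by (intro card_mono) (auto simp: H_def)
  then have "card Y \<le> card ?Y1 + 1 + deg (compl_rel E) Y v + card H"
    using card_Un_le[of "?Y1 \<union> {v} \<union> {u\<in>Y. compl_rel E v u}" H]
      card_Un_le[of "?Y1 \<union> {v}" "{u\<in>Y. compl_rel E v u}"] card_Un_le[of ?Y1 "{v}"]
    unfolding deg_def by simp
  moreover have "real (deg (compl_rel E) Y v) \<le> \<epsilon> * m" using codeg assms(5) by blast
  ultimately show ?thesis by linarith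
qed

text \<open>Without a cograph of size \<open>T\<close>, some \<open>v\<close> has a large
  non-neighbourhood in \<open>Y\<close>. A sparse subset of it would give such a cograph, and so
  would \<open>2 ^ k\<close> inner rounds in a dense one. So the rounds stop at a gap, and a cograph
  inside the set \<open>X\<close> found there is complete to almost all of \<open>Y\<close>.\<close>

lemma outer_step:
  assumes "symp E" "irreflp E" "finite V" "p5_free E V" "rich E V M (T / 2 ^ k)" "8 \<le> M" "1 \<le> T" "3 \<le> k"
    and "Y \<subseteq> V" "m / 2 \<le> real (card Y)" "real (card Y) \<le> m"
    and size: "M * T\<^sup>2 * loss k * 2 ^ (4 * k + 10) \<le> m"
    and codeg: "\<And>y. y \<in> Y \<Longrightarrow> real (deg (compl_rel E) Y y) \<le> m / 2 ^ (2 * k + 6)"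
    and no_cog: "\<not> (\<exists>Q\<subseteq>V. cog E Q \<and> T \<le> real (card Q))"
  shows "\<exists>Q Y'. Q \<subseteq> Y \<and> cog E Q \<and> T / 2 ^ k \<le> real (card Q) \<and> Y' \<subseteq> Y \<and> Q \<inter> Y' = {} \<and>
    (\<forall>x\<in>Q. \<forall>y\<in>Y'. E x y) \<and> real (card Y) - 2 * (1 / 2 ^ (k + 2)) * m \<le> real (card Y')"
proof -
  define p where "p = (2::real) ^ k"
  define L where "L = loss k"
  \<comment> \<open>With this \<open>d\<close>, \<open>2 ^ k\<close> inner rounds at cost
    \<open>2 * d\<close> use up exactly one half. \<open>B\<close> is the size for which
    \<open>\<theta> * (B / 2) = 8 ^ (k + 1) * M\<close>, where \<open>\<theta> = d / (2 * T)\<close>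
    is the scale of \<open>extend_over_gap\<close>.\<close>
  define d where "d = 1 / (4 * p)"
  define B where "B = 128 * (p ^ 4 * (M * T))"
  have p1: "1 \<le> p" unfolding p_def by simp
  have L1: "1 \<le> L" unfolding L_def by (rule loss_ge_1)
  have "8 ^ k = ((2::real) ^ 3) ^ k" by simp
  then have p8: "8 ^ k = p ^ 3" "2 ^ (2 * k + 6) = 64 * p\<^sup>2" "2 ^ (4 * k + 10) = 1024 * p ^ 4" "2 ^ (k + 2) = 4 * p"
    unfolding p_def by (simp_all only: power_add power_mult[symmetric] mult.commute[of _ k]) simp_all
  have d0: "0 < d" unfolding d_def using p1 by simp
  have MT: "M \<le> M * T" using assms(6,7) by simp
  have p34: "p ^ 3 \<le> p ^ 4" "1 \<le> p ^ 3" "p \<le> p ^ 4"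
    using p1 power_increasing[of 3 4 p] power_increasing[of 1 4 p] by auto
  have "1 * M \<le> p ^ 4 * (M * T)" using MT p34 assms(6) by (intro mult_mono) auto
  then have B1: "1024 \<le> B" "128 * M \<le> B" unfolding B_def using assms(6) by linarith+
  have "p ^ 3 * M \<le> p ^ 4 * (M * T)" using MT p34 assms(6) by (intro mult_mono) auto
  then have B2: "8 ^ k * M \<le> B" "8 ^ k * 8 \<le> B"
    unfolding B_def p8 using B1[unfolded B_def] p34 mult_left_mono[OF assms(6), of "p^3"] by linarith+
  \<comment> \<open>\<open>T\<close> is spent on the choice of \<open>v\<close> and \<open>L\<close>
    on the sparse or dense subset; the 8 covers \<open>Y\<close> having only half of
    \<open>m\<close>, a subtracted 1, and rounding \<open>B\<close> up.\<close>
  have mB: "8 * (L * B) * T \<le> m"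
    using size unfolding B_def L_def[symmetric] p8 by (simp add: power2_eq_square algebra_simps)
  have LB: "B \<le> L * B" using L1 B1 by simp
  have LBT: "L * B \<le> (L * B) * T" using assms(7) LB B1 by simp
  then have m0: "0 < m" "1024 \<le> m" using mB LB B1 by linarith+
  have fY: "finite Y" using assms(3,9) finite_subset by blast
  have Yne: "Y \<noteq> {}" using assms(10) m0 by auto
  have no_cogY: "\<not> (\<exists>Q\<subseteq>Y. cog E Q \<and> T \<le> real (card Q))"
    using no_cog subset_trans[OF _ assms(9)] by blast
  have T0: "0 < T" using assms(7) by simp
  obtain v where v: "v \<in> Y" "real (card Y) / T - 1 < real (deg (compl_rel E) Y v)"
    using large_codegree_vertex[OF assms(1) fY Yne T0 no_cogY] by blast
  define A where "A = {u\<in>Y. compl_rel E v u}"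
  have "4 * (L * B) * T \<le> real (card Y)" using mB assms(10) by linarith
  then have "4 * (L * B) \<le> real (card Y) / T" using T0 by (simp add: field_simps)
  then have A_big: "2 * (L * B) \<le> real (card A)" using v(2) LB B1 unfolding deg_def A_def by linarith
  have AV: "A \<subseteq> V" and AY: "A \<subseteq> Y" using assms(9) unfolding A_def by auto
  have fA: "finite A" using AV assms(3) finite_subset by blast
  define N where "N = nat \<lceil>B\<rceil>"
  have N: "B \<le> real N" "real N \<le> 2 * B" "1 \<le> N" using B1 unfolding N_def by linarith+
  have "real N * L \<le> 2 * B * L" using N(2) L1 by (intro mult_right_mono) auto
  also have "2 * B * L = 2 * (L * B)" by simp
  finally have "real N * L \<le> real (card A)" using A_big by linarith
  then have "real N * 2 ^ ((5 * k + 19) * (9 * k + 29)) \<le> real (card A)" unfolding L_def loss_def .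
  from sparse_or_dense_subset[OF assms(1) p5_free_subset[OF assms(4) AV] fA assms(8) N(3) this]
  obtain A' where A': "A' \<subseteq> A" "N \<le> card A'" and dich:
    "(\<forall>w\<in>A'. real (deg E A' w) \<le> real (card A') / 8 ^ (k + 1)) \<or>
     (\<forall>w\<in>A'. real (deg (compl_rel E) A' w) \<le> real (card A') / 2 ^ (2 * k + 6))" by blast
  have A'B: "B \<le> real (card A')" using N(1) A'(2) by linarith
  have A'V: "A' \<subseteq> V" using A'(1) AV by auto
  have "\<not> (\<forall>w\<in>A'. real (deg E A' w) \<le> real (card A') / 8 ^ (k + 1))"
  proof
    assume "\<forall>w\<in>A'. real (deg E A' w) \<le> real (card A') / 8 ^ (k + 1)"
    then have "\<exists>Q\<subseteq>A'. cog E Q \<and> 2 ^ k * (T / 2 ^ k) \<le> real (card Q)"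
      using B2 A'B by (intro cog_from_sparse[OF assms(1-5) A'V]) auto
    then obtain Q where "Q \<subseteq> A'" "cog E Q" "T \<le> real (card Q)" by auto
    then show False using no_cog subset_trans[OF _ A'V] by blast
  qed
  then have dense: "\<forall>w\<in>A'. real (deg (compl_rel E) A' w) \<le> real (card A') / (64 * p\<^sup>2)"
    using dich unfolding p8 by blast
  have codegA': "real (deg (compl_rel E) A' a) \<le> d * real (card A')" if "a \<in> A'" for a
  proof -
    have "1 / (64 * p\<^sup>2) \<le> d" unfolding d_def using p1 by (simp add: field_simps power2_eq_square)
    then have "1 / (64 * p\<^sup>2) * real (card A') \<le> d * real (card A')" by (intro mult_right_mono) auto
    then show ?thesis using dense that by fastforce
  qed
  define Yb where "Yb = {b\<in>Y. E v b}"
  define \<theta> where "\<theta> = d / (2 * T)"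
  have \<theta>0: "0 \<le> \<theta>" unfolding \<theta>_def using d0 T0 by simp
  have "8 ^ (k + 1) * M = \<theta> * (B / 2)"
    unfolding \<theta>_def d_def B_def using p1 T0 by (simp add: p8 field_simps power_numeral_reduce)
  also have "\<dots> \<le> \<theta> * (real (card A') / 2)" using A'B \<theta>0 by (intro mult_left_mono) auto
  finally have \<theta>A: "8 ^ (k + 1) * M \<le> \<theta> * (real (card A') / 2)" .
  have vV: "v \<in> V" and YbV: "Yb \<subseteq> V" and M0: "0 < M" and vYb: "\<forall>b\<in>Yb. E v b"
    using v(1) assms(6,9) unfolding Yb_def by auto
  have anti_vA: "anti E {v} A'" using A'(1) unfolding anti_def A_def compl_rel_def by auto
  have "real (card A') / 2 + real (2 ^ k) * (2 * d * real (card A')) \<le> real (card A')"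
    unfolding d_def using p1 by (simp add: p_def[symmetric])
  from inner_rounds[OF assms(1,3,4,5) M0 A'V vV YbV anti_vA vYb codegA' less_imp_le[OF d0] \<theta>0 \<theta>A no_cog order_refl this]
  have "(\<exists>X\<subseteq>A'. real (card A') / 2 \<le> real (card X) \<and> gap_pair E \<theta> d X Yb) \<or>
    (\<exists>Q\<subseteq>A'. cog E Q \<and> T \<le> real (card Q))" by simp
  then obtain X where X: "X \<subseteq> A'" "real (card A') / 2 \<le> real (card X)" "gap_pair E \<theta> d X Yb"
    using no_cog subset_trans[OF _ A'V] by blast
  have XY: "X \<subseteq> Y" and XV: "X \<subseteq> V" using X(1) A'(1) AY A'V by auto
  have Xne: "X \<noteq> {}" using X(2) A'B B1 by auto
  define Y1 where "Y1 = {b\<in>Y. E v b \<and> real (deg (compl_rel E) X b) < \<theta> * real (card X)}"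
  have codegY: "real (deg (compl_rel E) Y y) \<le> 1 / (64 * p\<^sup>2) * m" if "y \<in> Y" for y
    using codeg[OF that] unfolding p8 by simp
  have Y1_big: "real (card Y) - (1 + 1 / (64 * p\<^sup>2) * m + 1 / (64 * p\<^sup>2) * m / d) \<le> real (card Y1)"
    unfolding Y1_def using gap_exceptions[OF assms(1) fY XY Xne v(1) d0 codegY X(3)[unfolded Yb_def]] .
  \<comment> \<open>Each kind of exception amounts to at most \<open>m / (16 * p)\<close>, and three
    of these stay below \<open>d * m\<close>.\<close>
  have "16 * p \<le> m"
  proof -
    have "1 \<le> M * T" using MT assms(6) by linarith
    then have "p * 1 \<le> p ^ 4 * (M * T)" using p34 p1 by (intro mult_mono) auto
    then have "128 * p \<le> B" unfolding B_def by simp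
    then show ?thesis using mB LB LBT p1 by linarith
  qed
  then have e1: "1 \<le> m / (16 * p)" using p1 by (simp add: field_simps)
  have e2: "1 / (64 * p\<^sup>2) * m \<le> m / (16 * p)"
    using p1 m0 mult_right_mono[OF p1, of "p * m"] by (simp add: field_simps power2_eq_square)
  have e3: "1 / (64 * p\<^sup>2) * m / d = m / (16 * p)"
    unfolding d_def using p1 by (simp add: field_simps power2_eq_square)
  have e4: "3 * (m / (16 * p)) \<le> d * m" unfolding d_def using p1 m0 by (simp add: field_simps)
  have Y1_big: "real (card Y) - d * m \<le> real (card Y1)" using Y1_big e1 e2 e3 e4 by linarith
  have Y1V: "Y1 \<subseteq> V" and Y1Y: "Y1 \<subseteq> Y" using assms(9) unfolding Y1_def by auto
  have XY1: "X \<inter> Y1 = {}" using X(1) A'(1) unfolding A_def Y1_def compl_rel_def by auto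
  have low: "real (deg (compl_rel E) X y) \<le> d / (2 * T) * real (card X)" if "y \<in> Y1" for y
    using that unfolding Y1_def \<theta>_def by auto
  have "2 * M \<le> real (card X)" using X(2) A'B B1 assms(6) by linarith
  from extend_over_gap[OF assms(1,3,5) XV Y1V XY1 T0 less_imp_le[OF d0] low this no_cog]
  obtain Q Y' where Q: "Q \<subseteq> X" "cog E Q" "T / 2 ^ k \<le> real (card Q)" "Y' \<subseteq> Y1" "\<forall>x\<in>Q. \<forall>y\<in>Y'. E x y"
    "real (card Y1) - d * real (card Y1) \<le> real (card Y')" by blast
  have "d * real (card Y1) \<le> d * m"
    using card_mono[OF fY Y1Y] assms(11) d0 by (intro mult_left_mono) auto
  then have "real (card Y) - 2 * d * m \<le> real (card Y')" using Y1_big Q(6) by linarith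
  moreover have "d = 1 / 2 ^ (k + 2)" unfolding d_def p8 by simp
  moreover have "Q \<subseteq> Y" "Y' \<subseteq> Y" "Q \<inter> Y' = {}" using Q(1,4) XY Y1Y XY1 by auto
  ultimately show ?thesis using Q(2,3,5) by (intro exI[of _ Q] exI[of _ Y']) simp
qed

text \<open>Costs are measured against the fixed size of \<open>W\<close>, so that its codegree
  bound serves every \<open>Y\<close>. A round takes the share \<open>2 / 2 ^ (k + 2)\<close>, so
  one half pays for \<open>2 ^ k\<close> rounds.\<close>

lemma outer_rounds:
  assumes "symp E" "irreflp E" "finite V" "p5_free E V" "rich E V M (T / 2 ^ k)" "8 \<le> M" "1 \<le> T" "3 \<le> k"
    and "W \<subseteq> V" "M * T\<^sup>2 * loss k * 2 ^ (4 * k + 10) \<le> real (card W)"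
    and codeg: "\<And>w. w \<in> W \<Longrightarrow> real (deg (compl_rel E) W w) \<le> real (card W) / 2 ^ (2 * k + 6)"
    and "\<not> (\<exists>Q\<subseteq>V. cog E Q \<and> T \<le> real (card Q))"
    and "Y \<subseteq> W" "real (card W) / 2 + real j * (2 * (1 / 2 ^ (k + 2)) * real (card W)) \<le> real (card Y)"
  shows "\<exists>Q\<subseteq>Y. cog E Q \<and> real j * (T / 2 ^ k) \<le> real (card Q)"
  using assms(13,14)
proof (induction j arbitrary: Y)
  case 0
  have "{} \<subseteq> Y \<and> cog E {} \<and> real 0 * (T / 2 ^ k) \<le> real (card {})" by (simp add: cog_empty)
  then show ?case by blast
next
  case (Suc j)
  have fW: "finite W" using assms(3,9) finite_subset by blast
  have "0 \<le> real (Suc j) * (2 * (1 / 2 ^ (k + 2)) * real (card W))" by simp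
  then have half: "real (card W) / 2 \<le> real (card Y)" using Suc.prems(2) by linarith
  have le: "real (card Y) \<le> real (card W)" using card_mono[OF fW Suc.prems(1)] by simp
  have YV: "Y \<subseteq> V" using Suc.prems(1) assms(9) by auto
  have codegY: "real (deg (compl_rel E) Y y) \<le> real (card W) / 2 ^ (2 * k + 6)" if "y \<in> Y" for y
    using codeg[of y] that Suc.prems(1) deg_mono[OF fW Suc.prems(1), of "compl_rel E" y] by fastforce
  from outer_step[OF assms(1-8) YV half le assms(10) codegY assms(12)]
  obtain Q Y' where Q: "Q \<subseteq> Y" "cog E Q" "T / 2 ^ k \<le> real (card Q)" "Y' \<subseteq> Y" "Q \<inter> Y' = {}"
    "\<forall>x\<in>Q. \<forall>y\<in>Y'. E x y" "real (card Y) - 2 * (1 / 2 ^ (k + 2)) * real (card W) \<le> real (card Y')"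
      by blast
  have "real (card W) / 2 + real j * (2 * (1 / 2 ^ (k + 2)) * real (card W)) \<le> real (card Y')"
    using Q(7) Suc.prems(2) unfolding of_nat_Suc distrib_right by linarith
  from Suc.IH[OF subset_trans[OF Q(4) Suc.prems(1)] this] obtain Q' where
    "Q' \<subseteq> Y'" "cog E Q'" "real j * (T / 2 ^ k) \<le> real (card Q')" by blast
  from join_rounds[OF assms(3) Q(1-4) YV Q(5,6) this] show ?case by blast
qed

section \<open>Combining many parts, and classical doubling\<close>

text \<open>A sparse subset is split, a dense one undergoes \<open>2 ^ k\<close> outer rounds.
  \<open>loss k\<close> is squared because an outer round passes to a sparse or dense subset a
  second time; the exponent exceeds that of \<open>outer_rounds\<close> by one to pay for rounding
  \<open>m0\<close> up.\<close>

lemma cog_of_size_many_parts: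
  assumes "symp E" "irreflp E" "finite V" "p5_free E V" "rich E V M (T / 2 ^ k)" "8 \<le> M" "1 \<le> T" "3 \<le> k"
    and "M * T\<^sup>2 * (loss k)\<^sup>2 * 2 ^ (4 * k + 11) \<le> real (card V)"
  shows "\<exists>Q\<subseteq>V. cog E Q \<and> T \<le> real (card Q)"
proof (rule ccontr)
  assume no_cog: "\<not> ?thesis"
  define p where "p = (2::real) ^ k"
  define m0 where "m0 = M * T\<^sup>2 * loss k * 2 ^ (4 * k + 10)"
  have p1: "1 \<le> p" unfolding p_def by simp
  have "8 ^ k = ((2::real) ^ 3) ^ k" by simp
  then have p8: "8 ^ k = p ^ 3" "2 ^ (4 * k + 10) = 1024 * p ^ 4"
    unfolding p_def by (simp_all only: power_add power_mult[symmetric] mult.commute[of _ k]) simp_all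
  have p34: "p ^ 3 \<le> p ^ 4" "1 \<le> p ^ 3" using p1 power_increasing[of 3 4 p] by auto
  have "1 \<le> T\<^sup>2 * loss k" using assms(7) loss_ge_1[of k] mult_mono[of 1 "T\<^sup>2" 1 "loss k"] by simp
  then have "p ^ 3 * M * 1 \<le> (1024 * p ^ 4) * M * (T\<^sup>2 * loss k)"
    using p34 assms(6) by (intro mult_mono) auto
  then have m0M: "8 ^ k * M \<le> m0" unfolding m0_def p8 by (simp add: algebra_simps)
  have "8 ^ k * 8 \<le> 8 ^ k * M" using assms(6) by simp
  then have m08: "8 ^ k * 8 \<le> m0" using m0M by linarith
  have "1 \<le> (8::real) ^ k" by simp
  then have m01: "1 \<le> m0" using m08 by linarith
  define N where "N = nat \<lceil>m0\<rceil>"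
  have N: "m0 \<le> real N" "real N \<le> 2 * m0" "1 \<le> N" using m01 unfolding N_def by linarith+
  have "real N * loss k \<le> 2 * m0 * loss k" using N(2) loss_ge_1[of k] by (intro mult_right_mono) auto
  also have "\<dots> \<le> real (card V)"
    using assms(9) unfolding m0_def by (simp add: power2_eq_square power_add mult_ac)
  finally have "real N * 2 ^ ((5 * k + 19) * (9 * k + 29)) \<le> real (card V)" unfolding loss_def .
  from sparse_or_dense_subset[OF assms(1,4,3,8) N(3) this] obtain W where W: "W \<subseteq> V" "N \<le> card W"
    and dich: "(\<forall>w\<in>W. real (deg E W w) \<le> real (card W) / 8 ^ (k + 1)) \<or>
     (\<forall>w\<in>W. real (deg (compl_rel E) W w) \<le> real (card W) / 2 ^ (2 * k + 6))" by blast
  have Wm: "m0 \<le> real (card W)" using N(1) W(2) by linarith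
  have "\<exists>Q\<subseteq>W. cog E Q \<and> T \<le> real (card Q)"
    using dich
  proof
    assume "\<forall>w\<in>W. real (deg E W w) \<le> real (card W) / 8 ^ (k + 1)"
    then have "\<exists>Q\<subseteq>W. cog E Q \<and> 2 ^ k * (T / 2 ^ k) \<le> real (card Q)"
      using m0M m08 Wm by (intro cog_from_sparse[OF assms(1-5) W(1)]) auto
    then show ?thesis by simp
  next
    assume cd: "\<forall>w\<in>W. real (deg (compl_rel E) W w) \<le> real (card W) / 2 ^ (2 * k + 6)"
    have "real (card W) / 2 + real (2 ^ k) * (2 * (1 / 2 ^ (k + 2)) * real (card W)) \<le> real (card W)" by simp
    from outer_rounds[OF assms(1-8) W(1) Wm[unfolded m0_def] cd[rule_format] no_cog order_refl this]
    show ?thesis by simp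
  qed
  then show False using no_cog subset_trans[OF _ W(1)] by blast
qed

text \<open>In a sparse pair with \<open>e = 1 / (2 * T)\<close>, a cograph of fewer than
  \<open>T\<close> vertices on one side touches at most half of the other side, and a second one is
  taken in the rest. The constant 160 is 10 for the pair, 8 from \<open>e ^ 3\<close>, and 2 for the
  half.\<close>

lemma cog_of_size_two_parts:
  assumes "symp E" "finite V" "p5_free E V" "rich E V M (T / 2)" "1 \<le> M" "1 \<le> T"
    and "160 * M * T ^ 3 \<le> real (card V)"
  shows "\<exists>Q\<subseteq>V. cog E Q \<and> T \<le> real (card Q)"
proof (rule ccontr)
  assume no_cog: "\<not> ?thesis"
  define e where "e = 1 / (2 * T)"
  have e: "0 < e" "e \<le> 1/2" unfolding e_def using assms(6) by (simp_all add: field_simps)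
  have "1 * 1 \<le> M * T ^ 3" using assms(5,6) by (intro mult_mono) auto
  then have c5: "5 \<le> card V" using assms(7) by linarith
  have "2 * M = e ^ 3 * (160 * M * T ^ 3) / 10"
    unfolding e_def using assms(6) by (simp add: field_simps power_mult_distrib)
  also have "\<dots> \<le> e ^ 3 * real (card V) / 10"
    using assms(7) e by (intro divide_right_mono mult_left_mono) auto
  finally have M: "2 * M \<le> e ^ 3 * real (card V) / 10" .
  from p5_sparse_pair[OF assms(2,1,3) e c5] obtain A B where AB: "A \<subseteq> V" "B \<subseteq> V" "A \<inter> B = {}"
    "e ^ 3 * real (card V) / 10 \<le> real (card A)" "e ^ 3 * real (card V) / 10 \<le> real (card B)"
    "sparse_to E e A B \<or> sparse_to (compl_rel E) e A B" by blast
  have fB: "finite B" using AB(2) assms(2) finite_subset by blast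
  have "M \<le> real (card A)" using AB(4) M assms(5) by linarith
  from richE[OF assms(4) AB(1) this] obtain Q where Q: "Q \<subseteq> A" "cog E Q" "T / 2 \<le> real (card Q)"
    by blast
  have fQ: "finite Q" using Q(1) AB(1) assms(2) by (meson finite_subset)
  have cQ: "real (card Q) \<le> T" using no_cog Q(2) subset_trans[OF Q(1) AB(1)] by force
  \<comment> \<open>\<open>R\<close> covers both kinds of sparse pair; its absence between disjoint
    sets means anticomplete or complete.\<close>
  obtain R where R: "R = E \<or> R = compl_rel E" "sparse_to R e A B" using AB(6) by blast
  define B' where "B' = {y\<in>B. \<forall>x\<in>Q. \<not> R x y}"
  have "B \<subseteq> B' \<union> (\<Union>x\<in>Q. {y\<in>B. R x y})" unfolding B'_def by auto
  then have "card B \<le> card (B' \<union> (\<Union>x\<in>Q. {y\<in>B. R x y}))"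
    using fB fQ by (intro card_mono) (auto simp: B'_def)
  also have "\<dots> \<le> card B' + card (\<Union>x\<in>Q. {y\<in>B. R x y})" by (rule card_Un_le)
  also have "\<dots> \<le> card B' + (\<Sum>x\<in>Q. deg R B x)"
    unfolding deg_def using card_UN_le[OF fQ] by (intro add_left_mono)
  finally have "real (card B) \<le> real (card B' + (\<Sum>x\<in>Q. deg R B x))" by (rule of_nat_mono)
  then have "real (card B) \<le> real (card B') + (\<Sum>x\<in>Q. real (deg R B x))" by simp
  moreover have "(\<Sum>x\<in>Q. real (deg R B x)) \<le> real (card Q) * (e * real (card B))"
    using Q(1) R(2) by (intro sum_deg_le) (auto simp: sparse_to_def)
  moreover have "real (card Q) * (e * real (card B)) \<le> T * (e * real (card B))"
    using cQ e by (intro mult_right_mono) auto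
  moreover have "T * (e * real (card B)) = real (card B) / 2" unfolding e_def using assms(6) by simp
  ultimately have B'_big: "M \<le> real (card B')" using AB(5) M by linarith
  have B'B: "B' \<subseteq> B" unfolding B'_def by auto
  from richE[OF assms(4) subset_trans[OF B'B AB(2)] B'_big]
  obtain Q' where Q': "Q' \<subseteq> B'" "cog E Q'" "T / 2 \<le> real (card Q')" by blast
  have dis: "Q \<inter> Q' = {}" using Q(1) Q'(1) B'B AB(3) by auto
  have pure: "\<not> R a b" if "a \<in> Q" "b \<in> Q'" for a b using that Q'(1) unfolding B'_def by auto
  have "(\<forall>a\<in>Q. \<forall>b\<in>Q'. E a b) \<or> (\<forall>a\<in>Q. \<forall>b\<in>Q'. \<not> E a b)"
    using R(1)
  proof
    assume "R = E" then show ?thesis using pure by blast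
  next
    assume "R = compl_rel E"
    then have "E a b" if "a \<in> Q" "b \<in> Q'" for a b using pure[OF that] that dis unfolding compl_rel_def by auto
    then show ?thesis by blast
  qed
  then have "cog E (Q \<union> Q')" by (rule cog_union[OF Q(2) Q'(2) dis])
  moreover have "finite Q'" using Q'(1) B'B fB by (meson finite_subset)
  then have "T \<le> real (card (Q \<union> Q'))" using Q(3) Q'(3) fQ dis by (simp add: card_Un_disjoint)
  moreover have "Q \<union> Q' \<subseteq> V" using Q(1) Q'(1) B'B AB(1,2) by auto
  ultimately show False using no_cog by blast
qed

section \<open>The induction on the number of vertices\<close>

definition cograph_bound :: "real \<Rightarrow> real" where
  "cograph_bound r = 2 powr (log 2 r powr (2 / 3) / 16)"

lemma cograph_bound_mono: "1 \<le> r \<Longrightarrow> r \<le> r' \<Longrightarrow> cograph_bound r \<le> cograph_bound r'"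
  unfolding cograph_bound_def by (intro powr_mono divide_right_mono powr_mono2) auto

section \<open>Numerical inequalities for the induction\<close>

text \<open>Removes the fractional power, so that the growth conditions become polynomial.\<close>

lemma le_powr_two_thirds:
  fixes a b :: real
  assumes "0 \<le> b" "a ^ 3 \<le> b\<^sup>2"
  shows "a \<le> b powr (2 / 3)"
proof (cases "a \<le> 0")
  case True
  moreover have "0 \<le> b powr (2 / 3)" by simp
  ultimately show ?thesis by linarith
next
  case False
  have "b \<noteq> 0" using assms(2) False by auto
  then have b: "0 < b" using assms(1) by simp
  have "(a powr 3) powr (1 / 3) = a" using False by (simp only: powr_powr) simp
  then have "a = (a ^ 3) powr (1 / 3)" using False by (simp add: powr_numeral)
  also have "\<dots> \<le> (b\<^sup>2) powr (1 / 3)" using False assms(2) by (intro powr_mono2) auto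
  also have "\<dots> = (b powr 2) powr (1 / 3)" using b by (simp add: powr_numeral)
  also have "\<dots> = b powr (2 / 3)" by (simp only: powr_powr) simp
  finally show ?thesis .
qed

text \<open>\<open>x\<close> stands for the cube root of the logarithm of the size: a set smaller by
  the factor \<open>2 powr s\<close> still guarantees the target up to the factor
  \<open>2 ^ k\<close>.\<close>

lemma cograph_bound_decrease:
  assumes "s \<le> x ^ 3" "(x\<^sup>2 - 16 * real k) ^ 3 \<le> (x ^ 3 - s)\<^sup>2"
  shows "2 powr (x\<^sup>2 / 16) / 2 ^ k \<le> cograph_bound (2 powr (x ^ 3 - s))"
proof -
  have "x\<^sup>2 - 16 * real k \<le> (x ^ 3 - s) powr (2 / 3)" by (rule le_powr_two_thirds) (use assms in auto)
  then have "2 powr (x\<^sup>2 / 16 - real k) \<le> 2 powr ((x ^ 3 - s) powr (2 / 3) / 16)" by (intro powr_mono) auto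
  moreover have "2 powr (x\<^sup>2 / 16 - real k) = 2 powr (x\<^sup>2 / 16) / 2 ^ k"
    by (simp add: powr_diff powr_realpow)
  moreover have "log 2 (2 powr (x ^ 3 - s)) = x ^ 3 - s" by (rule log_powr_cancel) simp_all
  ultimately show ?thesis unfolding cograph_bound_def by simp
qed

lemma two_parts_inequality:
  fixes x :: real
  assumes "4 \<le> x" "x \<le> 64"
  shows "(x\<^sup>2 - 16) ^ 3 \<le> (x ^ 3 - (3 * x\<^sup>2 / 16 + 8))\<^sup>2" "3 * x\<^sup>2 / 16 + 8 \<le> x ^ 3"
proof -
  have x2: "16 \<le> x\<^sup>2" using assms(1) mult_mono[of 4 x 4 x] by (simp add: power2_eq_square)
  have "4 * x\<^sup>2 \<le> x * x\<^sup>2" using assms(1) by (intro mult_right_mono) auto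
  then have x3: "4 * x\<^sup>2 \<le> x ^ 3" by (simp add: power3_eq_cube power2_eq_square)
  then show "3 * x\<^sup>2 / 16 + 8 \<le> x ^ 3" using x2 by simp
  \<comment> \<open>This remains once the terms \<open>x ^ 6\<close> cancel and the square of
    \<open>3 * x\<^sup>2 / 16 + 8\<close> is dropped. For \<open>x\<close> up to 8 the constant 4096
    helps against \<open>768 * x\<^sup>2\<close>; beyond, \<open>x ^ 4\<close> suffices.\<close>
  have "3/8 * x ^ 5 + 16 * x ^ 3 \<le> 48 * x ^ 4 - 768 * x\<^sup>2 + 4096"
  proof (cases "x \<le> 8")
    case True
    have "x ^ 4 * (3/8 * x) \<le> x ^ 4 * 3" using True by (intro mult_left_mono) auto
    then have 1: "3/8 * x ^ 5 \<le> 3 * x ^ 4" by (simp add: eval_nat_numeral algebra_simps)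
    have "x ^ 3 * 16 \<le> x ^ 3 * (4 * x)" using assms(1) by (intro mult_left_mono) auto
    then have 2: "16 * x ^ 3 \<le> 4 * x ^ 4" by (simp add: eval_nat_numeral algebra_simps)
    \<comment> \<open>Completing the square in \<open>41 * x ^ 4 - 768 * x\<^sup>2\<close>,
      multiplied by 164.\<close>
    have "0 \<le> (82 * x\<^sup>2 - 768)\<^sup>2" by simp
    then have "768 * x\<^sup>2 \<le> 41 * x ^ 4 + 4096" by (simp add: power2_diff power2_eq_square eval_nat_numeral algebra_simps)
    then show ?thesis using 1 2 by simp
  next
    case False
    have "x ^ 4 * (3/8 * x) \<le> x ^ 4 * 24" using assms(2) by (intro mult_left_mono) auto
    then have 1: "3/8 * x ^ 5 \<le> 24 * x ^ 4" by (simp add: eval_nat_numeral algebra_simps)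
    have "x ^ 3 * 16 \<le> x ^ 3 * (4 * x)" using assms(1) by (intro mult_left_mono) auto
    then have 2: "16 * x ^ 3 \<le> 4 * x ^ 4" by (simp add: eval_nat_numeral algebra_simps)
    have "64 \<le> x\<^sup>2" using False mult_mono[of 8 x 8 x] by (simp add: power2_eq_square)
    then have "x\<^sup>2 * 64 \<le> x\<^sup>2 * x\<^sup>2" by (intro mult_left_mono) auto
    then have "64 * x\<^sup>2 \<le> x ^ 4" by (simp add: eval_nat_numeral algebra_simps)
    then show ?thesis using 1 2 \<open>64 \<le> x\<^sup>2\<close> by linarith
  qed
  moreover have "(x ^ 3 - (3 * x\<^sup>2 / 16 + 8))\<^sup>2 = x ^ 6 - (3/8 * x ^ 5 + 16 * x ^ 3) + (3 * x\<^sup>2 / 16 + 8)\<^sup>2"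
    by (simp add: power2_eq_square eval_nat_numeral field_simps)
  moreover have "(x\<^sup>2 - 16) ^ 3 = x ^ 6 - 48 * x ^ 4 + 768 * x\<^sup>2 - 4096"
    by (simp add: power2_eq_square eval_nat_numeral field_simps)
  moreover have "0 \<le> (3 * x\<^sup>2 / 16 + 8)\<^sup>2" by simp
  ultimately show "(x\<^sup>2 - 16) ^ 3 \<le> (x ^ 3 - (3 * x\<^sup>2 / 16 + 8))\<^sup>2" by linarith
qed

text \<open>\<open>s\<close> is the logarithm of the lost size factor, with \<open>c\<close> in the
  role of \<open>k\<close>. After the terms \<open>x ^ 6\<close> cancel,
  \<open>48 * c * x ^ 4\<close> must outweigh \<open>2 * s * x ^ 3\<close>, so \<open>s\<close> has
  to stay below about \<open>24 * c * x\<close>; \<open>c\<close> near \<open>x / 16\<close>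
  achieves this.\<close>

lemma many_parts_inequality:
  fixes x c :: real
  assumes "64 \<le> x" "4 \<le> c" "16 * c \<le> x" "x \<le> 16 * c + 16"
  defines "s \<equiv> x\<^sup>2 / 8 + 90 * c\<^sup>2 + 636 * c + 1113"
  shows "(x\<^sup>2 - 16 * c) ^ 3 \<le> (x ^ 3 - s)\<^sup>2" "s + 3 \<le> x ^ 3" "1 \<le> s"
proof -
  have c2: "4 * c \<le> c\<^sup>2" using assms(2) by (simp add: power2_eq_square)
  have c16: "16 \<le> c\<^sup>2" using c2 assms(2) by simp
  \<comment> \<open>The upper root is safe because \<open>16 * c + 16 \<le> 176 * c\<close>; the
    roots add up to \<open>192 * c\<close>, an eighth of which is the desired
    \<open>24 * c\<close>.\<close>
  have "0 \<le> (x - 16 * c) * (176 * c - x)" using assms by (intro mult_nonneg_nonneg) auto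
  then have "x\<^sup>2 / 8 \<le> 24 * (c * x) - 352 * c\<^sup>2" by (simp add: power2_eq_square algebra_simps)
  then have s1: "s \<le> 24 * (c * x) - 33 * c\<^sup>2" unfolding s_def using c2 c16 by simp
  have "0 \<le> x\<^sup>2" by simp
  then show "1 \<le> s" unfolding s_def using c2 c16 assms(2) by linarith
  have "16 * c * x \<le> x * x" using assms by (intro mult_right_mono) auto
  then have s2: "s \<le> 3/2 * x\<^sup>2 - 33 * c\<^sup>2" using s1 by (simp add: power2_eq_square)
  have "64 * x\<^sup>2 \<le> x * x\<^sup>2" using assms(1) by (intro mult_right_mono) auto
  then have x3: "64 * x\<^sup>2 \<le> x ^ 3" by (simp add: power3_eq_cube power2_eq_square)
  show "s + 3 \<le> x ^ 3" using s2 x3 c16 \<open>0 \<le> x\<^sup>2\<close> by linarith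
  have "s * x \<le> (24 * (c * x) - 33 * c\<^sup>2) * x" using s1 assms(1) by (intro mult_right_mono) auto
  moreover have "c\<^sup>2 * 384 \<le> c\<^sup>2 * (33 * x)" using assms(1) by (intro mult_left_mono) auto
  ultimately have "s * x \<le> 24 * c * x\<^sup>2 - 384 * c\<^sup>2" by (simp add: power2_eq_square algebra_simps)
  then have "(s * x) * (2 * x\<^sup>2) \<le> (24 * c * x\<^sup>2 - 384 * c\<^sup>2) * (2 * x\<^sup>2)"
    by (intro mult_right_mono) auto
  then have "2 * s * x ^ 3 \<le> 48 * c * x ^ 4 - 768 * c\<^sup>2 * x\<^sup>2"
    by (simp add: power2_eq_square eval_nat_numeral algebra_simps)
  moreover have "(x ^ 3 - s)\<^sup>2 = x ^ 6 - 2 * s * x ^ 3 + s\<^sup>2"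
    by (simp add: power2_eq_square eval_nat_numeral algebra_simps)
  moreover have "(x\<^sup>2 - 16 * c) ^ 3 = x ^ 6 - 48 * c * x ^ 4 + 768 * c\<^sup>2 * x\<^sup>2 - 4096 * c ^ 3"
    by (simp add: power2_eq_square eval_nat_numeral algebra_simps)
  moreover have "0 \<le> 4096 * c ^ 3" "0 \<le> s\<^sup>2" using assms(2) by auto
  ultimately show "(x\<^sup>2 - 16 * c) ^ 3 \<le> (x ^ 3 - s)\<^sup>2" by linarith
qed

text \<open>\<open>S\<close> may be all of \<open>V\<close>, so the hypothesis is applied to a
  subset of \<open>M\<close> vertices, rounded up; it is smaller than \<open>V\<close> because
  \<open>M\<close> is at most half.\<close>

lemma rich_from_smaller:
  assumes "finite V" "2 \<le> card V" "1 \<le> M" "M \<le> real (card V) / 2" "q \<le> cograph_bound M"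
    and IH: "\<And>U. U \<subseteq> V \<Longrightarrow> card U < card V \<Longrightarrow> U \<noteq> {} \<Longrightarrow> \<exists>Q\<subseteq>U. cog E Q \<and> cograph_bound (real (card U)) \<le> real (card Q)"
  shows "rich E V M q"
  unfolding rich_def
proof (intro allI impI)
  fix S assume S: "S \<subseteq> V" "M \<le> real (card S)"
  define N where "N = nat \<lceil>M\<rceil>"
  have N: "M \<le> real N" "N \<le> card S" "real N < M + 1" "1 \<le> N"
    using S(2) assms(3) unfolding N_def by linarith+
  obtain U where U: "U \<subseteq> S" "card U = N" using N(2) by (meson obtain_subset_with_card_n)
  have "N < card V" using N(3) assms(2,4) by linarith
  moreover have "U \<noteq> {}" using U(2) N(4) by auto
  ultimately obtain Q where "Q \<subseteq> U" "cog E Q" "cograph_bound (real (card U)) \<le> real (card Q)"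
    using IH[of U] U S(1) by (metis subset_trans)
  moreover have "q \<le> cograph_bound (real (card U))"
    using assms(5) cograph_bound_mono[OF assms(3), of "real N"] N(1) U(2) by simp
  ultimately show "\<exists>Q\<subseteq>S. cog E Q \<and> q \<le> real (card Q)" using U(1) by (meson order_trans)
qed

lemma two_vertex_cog:
  assumes "2 \<le> card V"
  shows "\<exists>Q\<subseteq>V. cog E Q \<and> card Q = 2"
proof -
  obtain Q where Q: "Q \<subseteq> V" "card Q = 2" using assms by (meson obtain_subset_with_card_n)
  then obtain a b where ab: "Q = {a, b}" "a \<noteq> b" by (meson card_2_iff)
  have "cog E ({a} \<union> {b})" by (rule cog_union) (use ab(2) in \<open>auto intro: cog_single\<close>)
  then show ?thesis using Q ab by (metis insert_is_Un)
qed

text \<open>Three ranges of the cube root \<open>x\<close> of the logarithm: up to 4 the target is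
  at most 2, up to 64 doubling suffices, and above that \<open>2 ^ k\<close> parts are combined with
  \<open>k\<close> about \<open>x / 16\<close>.\<close>

lemma large_cog:
  assumes "symp E" "irreflp E" "finite V" "p5_free E V" "V \<noteq> {}"
  shows "\<exists>Q\<subseteq>V. cog E Q \<and> cograph_bound (real (card V)) \<le> real (card Q)"
  using assms(3-)
proof (induction "card V" arbitrary: V rule: less_induct)
  case less
  define n where "n = real (card V)"
  \<comment> \<open>In terms of \<open>x\<close> the logarithm of \<open>n\<close> is
    \<open>x ^ 3\<close> and that of the target \<open>x\<^sup>2 / 16\<close>.\<close>
  define x where "x = log 2 n powr (1 / 3)"
  have c1: "1 \<le> card V" using less.prems by (simp add: Suc_le_eq card_gt_0_iff)
  then have n1: "1 \<le> n" unfolding n_def by simp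
  have L0: "0 \<le> log 2 n" using n1 by simp
  have x0: "0 \<le> x" unfolding x_def by simp
  have x2: "x\<^sup>2 = log 2 n powr (2 / 3)" unfolding x_def by (simp add: power2_eq_square flip: powr_add)
  have x3: "x ^ 3 = log 2 n" using L0 unfolding x_def by (simp add: power3_eq_cube flip: powr_add)
  have n: "n = 2 powr (x ^ 3)" unfolding x3 using n1 by simp
  define T where "T = 2 powr (x\<^sup>2 / 16)"
  have T: "cograph_bound n = T" unfolding T_def cograph_bound_def x2 ..
  have T1: "1 \<le> T" unfolding T_def by (rule ge_one_powr_ge_zero) auto
  have IH: "\<exists>Q\<subseteq>U. cog E Q \<and> cograph_bound (real (card U)) \<le> real (card Q)"
    if "U \<subseteq> V" "card U < card V" "U \<noteq> {}" for U
    using less.hyps[OF that(2) finite_subset[OF that(1) less.prems(1)] p5_free_subset[OF less.prems(2) that(1)] that(3)] .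
  have richI: "rich E V (2 powr (x ^ 3 - s)) (T / 2 ^ k)"
    if "4 \<le> x" "(x\<^sup>2 - 16 * real k) ^ 3 \<le> (x ^ 3 - s)\<^sup>2" "s \<le> x ^ 3" "1 \<le> s" for s k
  proof (rule rich_from_smaller[OF less.prems(1)])
    have "4 ^ 3 \<le> x ^ 3" using that(1) by (intro power_mono) auto
    then have "2 powr 1 \<le> n" unfolding n by (intro powr_mono) auto
    then show "2 \<le> card V" unfolding n_def by simp
    show "1 \<le> 2 powr (x ^ 3 - s)" using that(3) by (intro ge_one_powr_ge_zero) auto
    have "2 powr (x ^ 3 - s) \<le> 2 powr (x ^ 3 - 1)" using that(4) by (intro powr_mono) auto
    then show "2 powr (x ^ 3 - s) \<le> real (card V) / 2" unfolding n_def[symmetric] n by (simp add: powr_diff)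
    show "T / 2 ^ k \<le> cograph_bound (2 powr (x ^ 3 - s))"
      unfolding T_def by (rule cograph_bound_decrease[OF that(3,2)])
  qed (rule IH)
  have "\<exists>Q\<subseteq>V. cog E Q \<and> T \<le> real (card Q)"
  proof (cases "x \<le> 4")
    case True
    show ?thesis
    proof (cases "card V = 1")
      case True
      then obtain v where "V = {v}" by (meson card_1_singletonE)
      \<comment> \<open>\<open>0 powr (1 / 3)\<close> is 0, so the target for a single vertex is
        1.\<close>
      moreover have "x = 0" unfolding x_def n_def using True by simp
      then have "T = 1" unfolding T_def by simp
      ultimately have "V \<subseteq> V \<and> cog E V \<and> T \<le> real (card V)" by (simp add: cog_single)
      then show ?thesis by blast
    next
      case False
      have "2 \<le> card V" using False c1 by simp
      from two_vertex_cog[OF this, of E] obtain Q where Q: "Q \<subseteq> V" "cog E Q" "card Q = 2" by blast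
      have "T \<le> 2"
      proof -
        have "x\<^sup>2 \<le> 4\<^sup>2" using True x0 by (intro power_mono) auto
        then have "T \<le> 2 powr 1" unfolding T_def by (intro powr_mono) auto
        then show ?thesis by simp
      qed
      then have "T \<le> real (card Q)" using Q(3) by simp
      then show ?thesis using Q(1,2) by blast
    qed
  next
    case x4: False
    show ?thesis
    proof (cases "x \<le> 64")
      case True
      \<comment> \<open>\<open>3 * x\<^sup>2 / 16\<close> is the logarithm of \<open>T ^ 3\<close>,
        and the 8 covers the constant 160.\<close>
      define s where "s = 3 * x\<^sup>2 / 16 + 8"
      have s1: "1 \<le> s" unfolding s_def using zero_le_power2[of x] by linarith
      have le: "s \<le> x ^ 3" using two_parts_inequality(2)[of x] x4 True unfolding s_def by simp
      have rich: "rich E V (2 powr (x ^ 3 - s)) (T / 2 ^ 1)"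
        using two_parts_inequality(1)[of x] x4 True le s1 by (intro richI) (auto simp: s_def)
      have "160 * 2 powr (x ^ 3 - s) * T ^ 3 \<le> 2 powr 8 * 2 powr (x ^ 3 - s) * 2 powr (3 * (x\<^sup>2 / 16))"
        unfolding T_def by (intro mult_mono) (auto simp: powr_powr mult.commute simp flip: powr_realpow)
      also have "\<dots> = 2 powr (x ^ 3)" unfolding s_def powr_add[symmetric] by simp
      finally have "160 * 2 powr (x ^ 3 - s) * T ^ 3 \<le> real (card V)" using n n_def by simp
      moreover have "1 \<le> 2 powr (x ^ 3 - s)" using le by (intro ge_one_powr_ge_zero) auto
      ultimately show ?thesis
        using cog_of_size_two_parts[OF assms(1) less.prems(1,2), of "2 powr (x ^ 3 - s)" T] rich T1 by simp
    next
      case x64: False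
      define k where "k = nat \<lfloor>x / 16\<rfloor>"
      have k4: "4 \<le> k" using x64 unfolding k_def by linarith
      have k: "16 * real k \<le> x" "x \<le> 16 * real k + 16" using x0 unfolding k_def by linarith+
      \<comment> \<open>\<open>x\<^sup>2 / 8\<close> comes from \<open>T\<^sup>2\<close>, the
        polynomial in \<open>k\<close> from \<open>(loss k)\<^sup>2\<close> and
        \<open>2 ^ (4 * k + 11)\<close>, so that the required size is exactly
        \<open>n\<close>.\<close>
      define s where "s = x\<^sup>2 / 8 + 90 * (real k)\<^sup>2 + 636 * real k + 1113"
      have ineq: "(x\<^sup>2 - 16 * real k) ^ 3 \<le> (x ^ 3 - s)\<^sup>2" "s + 3 \<le> x ^ 3" "1 \<le> s"
        unfolding s_def using many_parts_inequality[of x "real k"] x64 k4 k by auto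
      have rich: "rich E V (2 powr (x ^ 3 - s)) (T / 2 ^ k)"
        using ineq x64 by (intro richI) auto
      have "2 powr 3 \<le> 2 powr (x ^ 3 - s)" using ineq(2) by (intro powr_mono) auto
      then have M8: "8 \<le> 2 powr (x ^ 3 - s)" by simp
      have T2: "T\<^sup>2 = 2 powr (x\<^sup>2 / 8)" unfolding T_def by (simp add: power2_eq_square flip: powr_add)
      have l2: "(loss k)\<^sup>2 = 2 powr (90 * (real k)\<^sup>2 + 632 * real k + 1102)"
        unfolding loss_def power_mult[symmetric]
        by (subst powr_realpow[symmetric]) (simp_all add: power2_eq_square algebra_simps)
      have p2: "2 ^ (4 * k + 11) = 2 powr (4 * real k + 11)"
        by (subst powr_realpow[symmetric]) simp_all
      have "2 powr (x ^ 3 - s) * T\<^sup>2 * (loss k)\<^sup>2 * 2 ^ (4 * k + 11) = 2 powr (x ^ 3)"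
        unfolding T2 l2 p2 s_def powr_add[symmetric] by simp
      then have "2 powr (x ^ 3 - s) * T\<^sup>2 * (loss k)\<^sup>2 * 2 ^ (4 * k + 11) \<le> real (card V)"
        using n n_def by simp
      from cog_of_size_many_parts[OF assms(1,2) less.prems(1,2) rich M8 T1 _ this] k4 show ?thesis by simp
    qed
  qed
  then show ?case using T unfolding n_def by simp
qed

section \<open>Transfer to digraphs\<close>

definition adj :: "('a, 'b) pre_digraph \<Rightarrow> 'a \<Rightarrow> 'a \<Rightarrow> bool" where
  "adj G u v \<longleftrightarrow> u \<rightarrow>\<^bsub>G\<^esub> v"

lemma (in graph) symp_adj: "symp (adj G)"
  using sym_arcs unfolding symp_def adj_def symmetric_def sym_def by blast

lemma (in graph) irreflp_adj: "irreflp (adj G)"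
  unfolding irreflp_def adj_def using adj_not_same by blast

lemma (in graph) adj_iff: "adj G u v \<longleftrightarrow> (\<exists>e\<in>arcs G. tail G e = u \<and> head G e = v)"
  unfolding adj_def arcs_ends_def arc_to_ends_def by auto

lemma adj_induce_subgraph: "adj (G \<restriction> S) u v \<longleftrightarrow> u \<in> S \<and> v \<in> S \<and> adj G u v"
  unfolding adj_def arcs_ends_def arc_to_ends_def by auto

lemma (in graph) graph_induce_subgraph:
  assumes "S \<subseteq> verts G"
  shows "graph (G \<restriction> S)"
proof
  have "adj (G \<restriction> S) v u" if "adj (G \<restriction> S) u v" for u v
    using that symp_adj by (auto simp: adj_induce_subgraph dest: sympD)
  then show "symmetric (G \<restriction> S)" unfolding symmetric_def sym_def adj_def by blast
next
  fix e1 e2 assume "e1 \<in> arcs (G \<restriction> S)" "e2 \<in> arcs (G \<restriction> S)" "arc_to_ends (G \<restriction> S) e1 = arc_to_ends (G \<restriction> S) e2"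
  then show "e1 = e2" by (intro no_multi_arcs) (auto simp: arc_to_ends_def)
qed (use assms finite_subset[OF assms finite_verts] no_loops in auto)

lemma (in graph) cograph_of_cog:
  assumes "cog (adj G) Q" "Q \<subseteq> verts G" "Q \<noteq> {}"
  shows "cograph (G \<restriction> Q)"
  using assms
proof (induction rule: cog.induct)
  case cog_empty
  then show ?case by simp
next
  case (cog_single v)
  then show ?case using graph_induce_subgraph[of "{v}"] by (intro cograph.single_vertex[of _ v]) auto
next
  case (cog_union A B)
  show ?case
  proof (cases "A = {} \<or> B = {}")
    \<comment> \<open>No empty graph is a \<open>cograph\<close>: an empty part is dropped, and the
      other one is the whole union.\<close>
    case True
    then consider "A \<union> B = B" "B \<noteq> {}" | "A \<union> B = A" "A \<noteq> {}"
      using cog_union.prems(2) by auto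
    then show ?thesis by cases (use cog_union.IH cog_union.prems(1) in simp_all)
  next
    case False
    have A: "cograph (G \<restriction> A)" and B: "cograph (G \<restriction> B)" using cog_union False by auto
    have restr: "(G \<restriction> (A \<union> B)) \<restriction> A = G \<restriction> A" "(G \<restriction> (A \<union> B)) \<restriction> B = G \<restriction> B"
      unfolding induce_subgraph_def by auto
    have dom: "a \<rightarrow>\<^bsub>G \<restriction> (A \<union> B)\<^esub> b \<longleftrightarrow> adj G a b" if "a \<in> A" "b \<in> B" for a b
      using adj_induce_subgraph[of G "A \<union> B" a b] that unfolding adj_def[of "G \<restriction> (A \<union> B)"] by simp
    have pure: "pure_pair (G \<restriction> (A \<union> B)) A B"
      using cog_union.hyps(3,4) by (auto simp: pure_pair_def dom)
    show ?thesis
      by (rule cograph.disjoint_union[OF graph_induce_subgraph[OF cog_union.prems(1)] _ pure])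
        (simp_all only: restr A B induce_subgraph_verts)
  qed
qed

text \<open>Vertices of P5 have pairwise different neighbourhoods, so injectivity of an embedding
  follows from the adjacencies alone.\<close>

lemma path5_neighbours_inj:
  fixes i j :: nat
  assumes "i < 5" "j < 5" "\<And>l. l < 5 \<Longrightarrow> (l = Suc i \<or> i = Suc l) = (l = Suc j \<or> j = Suc l)"
  shows "i = j"
  using assms(1,2) assms(3)[of "Suc i"] assms(3)[of "Suc j"] assms(3)[of 3] assms(3)[of 1] by presburger

lemma (in graph) induced_path5_copy:
  assumes g: "\<And>i. i < 5 \<Longrightarrow> g i \<in> verts G"
    and adj: "\<And>i j. i < 5 \<Longrightarrow> j < 5 \<Longrightarrow> adj G (g i) (g j) \<longleftrightarrow> j = Suc i \<or> i = Suc j"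
  shows "contains_induced_copy G (with_proj (path_graph 5))"
proof -
  define S where "S = g ` {..<5::nat}"
  have SV: "S \<subseteq> verts G" using g unfolding S_def by auto
  interpret H: graph "G \<restriction> S" using graph_induce_subgraph[OF SV] .
  have inj: "inj_on g {..<5}"
  proof (rule inj_onI)
    fix i j assume ij: "i \<in> {..<5::nat}" "j \<in> {..<5}" "g i = g j"
    show "i = j"
    proof (rule path5_neighbours_inj)
      fix l :: nat assume l: "l < 5"
      have "i < 5" "j < 5" using ij(1,2) by simp_all
      from adj[OF this(1) l] adj[OF this(2) l] show "(l = Suc i \<or> i = Suc l) = (l = Suc j \<or> j = Suc l)"
        unfolding ij(3) by (rule trans[OF sym])
    qed (use ij in auto)
  qed
  define f where "f = the_inv_into {..<5} g"
  have fg: "f (g i) = i" if "i < 5" for i using that inj unfolding f_def by (simp add: the_inv_into_f_f)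
  have gf: "g (f u) = u" "f u < 5" if u: "u \<in> S" for u
  proof -
    obtain i where "i < 5" "u = g i" using u unfolding S_def by auto
    then show "g (f u) = u" "f u < 5" using fg[of i] by simp_all
  qed
  \<comment> \<open>Arcs of the path are pairs of vertices, so each arc goes to the pair of images
    of its ends; this is injective because there are no parallel arcs.\<close>
  define h :: "('a, 'b, nat, nat \<times> nat) digraph_isomorphism" where
    "h = digraph_isomorphism.make f (\<lambda>e. (f (tail G e), f (head G e))) snd fst"
  have h: "iso_verts h = f" "iso_arcs h = (\<lambda>e. (f (tail G e), f (head G e)))" "iso_head h = snd" "iso_tail h = fst"
    unfolding h_def digraph_isomorphism.make_def by simp_all
  have arcs_inj: "inj_on (\<lambda>e. (f (tail G e), f (head G e))) (arcs (G \<restriction> S))"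
  proof (rule inj_onI)
    fix e1 e2 assume e: "e1 \<in> arcs (G \<restriction> S)" "e2 \<in> arcs (G \<restriction> S)"
      "(f (tail G e1), f (head G e1)) = (f (tail G e2), f (head G e2))"
    have "tail G e1 = tail G e2"
      using e gf(1)[of "tail G e1"] gf(1)[of "tail G e2"] by (metis (no_types, lifting) induce_subgraph_arcs mem_Collect_eq prod.inject)
    moreover have "head G e1 = head G e2"
      using e gf(1)[of "head G e1"] gf(1)[of "head G e2"] by (metis (no_types, lifting) induce_subgraph_arcs mem_Collect_eq prod.inject)
    ultimately show "e1 = e2" using e(1,2) by (intro no_multi_arcs) (simp_all add: arc_to_ends_def)
  qed
  have "inj_on f S" by (rule inj_on_inverseI) (rule gf)
  then have "pre_digraph.digraph_isomorphism (G \<restriction> S) h"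
    unfolding pre_digraph.digraph_isomorphism_def h using arcs_inj H.wf_digraph by simp
  moreover have "with_proj (path_graph 5) = app_iso h (G \<restriction> S)"
  proof -
    have "f ` S = {..<5}" using fg unfolding S_def by (auto simp: image_image)
    moreover have "(\<lambda>e. (f (tail G e), f (head G e))) ` arcs (G \<restriction> S) =
      {(i, j). i < 5 \<and> j < 5 \<and> (j = Suc i \<or> i = Suc j)}" (is "?L = ?R")
    proof
      show "?L \<subseteq> ?R"
      proof
        fix p assume "p \<in> ?L"
        then obtain e where e: "e \<in> arcs G" "tail G e \<in> S" "head G e \<in> S" "p = (f (tail G e), f (head G e))"
          by auto
        have "adj G (g (f (tail G e))) (g (f (head G e)))" using e gf(1) adj_iff by auto
        then show "p \<in> ?R" using adj gf(2) e by auto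
      qed
      show "?R \<subseteq> ?L"
      proof
        fix p assume "p \<in> ?R"
        then obtain i j where p: "p = (i, j)" "i < 5" "j < 5" "j = Suc i \<or> i = Suc j" by auto
        then have "adj G (g i) (g j)" using adj by blast
        then obtain e where e: "e \<in> arcs G" "tail G e = g i" "head G e = g j" using adj_iff by blast
        then have "e \<in> arcs (G \<restriction> S)" using p unfolding S_def by auto
        moreover have "p = (f (tail G e), f (head G e))" using e fg p by simp
        ultimately show "p \<in> ?L" by blast
      qed
    qed
    ultimately show ?thesis unfolding app_iso_def with_proj_def path_graph_def h by simp
  qed
  moreover have "induced_subgraph (G \<restriction> S) G" using SV by (rule induced_induce)
  ultimately show ?thesis unfolding contains_induced_copy_def digraph_iso_def by blast
qed

lemma (in graph) p5_free_adj:
  assumes "\<not> contains_induced_copy G (with_proj (path_graph 5))"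
  shows "p5_free (adj G) (verts G)"
proof (rule ccontr)
  assume "\<not> ?thesis"
  then obtain a b c d e where V: "a \<in> verts G" "b \<in> verts G" "c \<in> verts G" "d \<in> verts G" "e \<in> verts G"
    and p: "adj G a b" "adj G b c" "adj G c d" "adj G d e"
    and np: "\<not> adj G a c" "\<not> adj G a d" "\<not> adj G a e" "\<not> adj G b d" "\<not> adj G b e" "\<not> adj G c e"
    unfolding p5_free_def by blast
  have nsym: "\<not> adj G x y \<Longrightarrow> \<not> adj G y x" for x y using symp_adj by (meson sympD)
  have irr: "\<not> adj G x x" for x using irreflp_adj by (meson irreflpD)
  define g where "g = (\<lambda>i. [a, b, c, d, e] ! i)"
  have gs: "g 0 = a" "g (Suc 0) = b" "g 2 = c" "g 3 = d" "g 4 = e" unfolding g_def by simp_all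
  have five: "i = 0 \<or> i = 1 \<or> i = 2 \<or> i = 3 \<or> i = 4" if "i < 5" for i :: nat using that by auto
  have "contains_induced_copy G (with_proj (path_graph 5))"
  proof (rule induced_path5_copy)
    fix i :: nat assume "i < 5"
    from five[OF this] show "g i \<in> verts G" by (elim disjE) (simp_all add: V gs)
  next
    fix i j :: nat assume "i < 5" "j < 5"
    from five[OF this(1)] five[OF this(2)] show "adj G (g i) (g j) \<longleftrightarrow> j = Suc i \<or> i = Suc j"
      by (elim disjE) (simp_all add: gs p p[THEN sympD[OF symp_adj]] np np[THEN nsym] irr)
  qed
  then show False using assms by simp
qed

theorem theorem3p6:
  fixes G :: "('a, 'b) pre_digraph" and n :: nat
  assumes "graph G"
    and "card (verts G) = n" and "n \<ge> 1"
    and "\<not> contains_induced_copy G (with_proj (path_graph 5))"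
  shows "\<exists>H. induced_subgraph H G \<and> cograph H \<and>
           real (card (verts H)) \<ge> 2 powr ((log 2 (real n)) powr (2 / 3) / 16)"
proof -
  interpret graph G by (rule assms(1))
  have "verts G \<noteq> {}" using assms(2,3) by auto
  from large_cog[OF symp_adj irreflp_adj finite_verts p5_free_adj[OF assms(4)] this]
  obtain Q where Q: "Q \<subseteq> verts G" "cog (adj G) Q" "cograph_bound (real n) \<le> real (card Q)"
    using assms(2) by blast
  \<comment> \<open>A positive bound makes \<open>Q\<close> nonempty, as \<open>cograph\<close>
    demands.\<close>
  have "0 < cograph_bound (real n)" unfolding cograph_bound_def by simp
  then have "Q \<noteq> {}" using Q(3) by auto
  then have "cograph (G \<restriction> Q)" using cograph_of_cog Q by blast
  moreover have "induced_subgraph (G \<restriction> Q) G" using Q(1) by (rule induced_induce)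
  ultimately show ?thesis using Q(3) unfolding cograph_bound_def by (intro exI[of _ "G \<restriction> Q"]) simp
qed

end
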